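(* Let $\varepsilon>0$ be given and let the relation $r_2\le\frac{q_3}{2}$ hold. Define $$t_r=\frac{\pi/2}{\bar\omega},\qquad t_l=\frac{\sqrt{4\bar y^2+(\bar\lambda+\varepsilon)^2}}{\bar v},\qquad t_g=\frac{|\bar\lambda|}{\hat g},$$ and $$c(t)=\begin{cases}1+\dfrac{q_3\pi^2(t^2+6t_rt+0.5)}{4t_r^2\,\hat q\,\varepsilon^2}, & t\in[0,t_r),\\[2mm] 1+\dfrac{q_3(3\pi/2)^2+r_1\bar v^2}{\hat q\,\varepsilon^2}, & t\in[t_r,t_r+t_l),\\[2mm] 1+\dfrac{q_3\pi^2\big((4t_r+t_l-t)^2+0.5\big)}{4t_r^2\,\hat q\,\varepsilon^2}, & t\in[t_r+t_l,4t_r+t_l),\\[2mm] \dfrac{(4t_r+t_l+t_g-t)^2+\hat r\,\hat q^{-1}}{t_g^2}, & t\in[4t_r+t_l,4t_r+t_l+t_g),\\[2mm] 0,&\text{otherwise.}\end{cases}$$ Then the function $B\in\mathcal{PC}([0,\infty),\mathbb{R}_{\ge0})$, $B(t):=\min\{t,\int_0^tc(s)\,\mathrm{d}s\}$, satisfies, for all $\mathbf{z}_0\in Z_\varepsilon$, $$V_t(\mathbf{z}_0)\le B(t)\cdot\ell^\star(\mathbf{z}_0)\qquad\forall\,t\ge0.$$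
   Context: Constraints: let $\bar x,\bar y,\bar v,\bar\omega,\bar g>0$, $\bar\lambda=-\bar x$, $\varepsilon\in[0,\bar x)$; $X_\varepsilon=[-\bar x,-\varepsilon]\times[-\bar y,\bar y]\times\mathbb{R}$, $U=[-\bar v,\bar v]\times[-\bar\omega,\bar\omega]$, $G=[0,\bar g]$, $W=U\times G$. $\mathcal{PC}$ denotes piecewise continuous functions. Path: $\mathcal{P}=\{p(\lambda):\lambda\in[\bar\lambda,0]\}\subset X_0$ with $p(\lambda)=\big(\lambda,\rho(\lambda),\arctan(\rho'(\lambda))\big)^\top$, $\rho$ at least twice continuously differentiable, and $p(0)=0$. Augmented dynamics: state $\mathbf{z}=(\mathbf{x}^\top,\lambda)^\top\in\mathbb{R}^4$ with robot state $\mathbf{x}=(x,y,\theta)^\top$ and path parameter $\lambda$; input $\mathbf{w}=(\mathbf{u}^\top,g)^\top\in\mathbb{R}^3$ with $\mathbf{u}=(v,\omega)^\top$: $$\dot x=v\cos\theta,\quad\dot y=v\sin\theta,\quad\dot\theta=\omega,\quad\dot\lambda=g,$$ written $\dot{\mathbf z}=\mathbf{f}_g(\mathbf{z},\mathbf{w})$. The trajectory from $\mathbf{z}_0$ under $\mathbf{w}$ is $\mathbf{z}(\cdot;\mathbf{z}_0,\mathbf{w})$. The augmented state constraint set is $$Z_\varepsilon=X_\varepsilon\times[\bar\lambda,-\varepsilon]\ \cup\ \{(p(\lambda)^\top,\lambda)^\top:\lambda\in(-\varepsilon,0]\}.$$ Reference input: $\mathbf{u}_{ref}(\lambda,g)=(v_{ref},\omega_{ref})^\top$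 with $v_{ref}(\lambda,g)=g\sqrt{1+\rho'(\lambda)^2}$ and $\omega_{ref}(\lambda,g)=g\,\rho''(\lambda)/(1+\rho'(\lambda)^2)$; and $\hat g:=\max\{g\in[0,\bar g]:\mathbf{u}_{ref}(\lambda,g)\in U\ \forall\lambda\in[\bar\lambda,0]\}$ (which is positive). Costs: with $\|\mathbf{a}\|_{\mathbf{M}}^2=\mathbf{a}^\top\mathbf{M}\mathbf{a}$, $\mathbf{Q}=\mathrm{diag}(q_1,q_2,q_3,\hat q)$ and $\mathbf{R}=\mathrm{diag}(r_1,r_2,\hat r)$ positive definite, $$\ell(\mathbf{z},\mathbf{w})=\left\|\begin{pmatrix}\mathbf{x}-p(\lambda)\\ \lambda\end{pmatrix}\right\|_{\mathbf{Q}}^2+\left\|\begin{pmatrix}\mathbf{u}-\mathbf{u}_{ref}(\lambda,g)\\ g\end{pmatrix}\right\|_{\mathbf{R}}^2,\qquad \ell^\star(\mathbf{z}_0):=\min_{\mathbf{w}\in W}\ell(\mathbf{z}_0,\mathbf{w}).$$ For $T>0$, the value function is $$V_T(\mathbf{z}_0)=\min_{\mathbf{w}}\int_0^T\ell(\mathbf{z}(\tau;\mathbf{z}_0,\mathbf{w}),\mathbf{w}(\tau))\,\mathrm{d}\tau,$$ the minimum being over $\mathbf{w}\in\mathcal{PC}([0,T),\mathbb{R}^3)$ with $\mathbf{w}(\tau)\in W$ for $\tau\in[0,T)$ and $\mathbf{z}(\tau;\mathbf{z}_0,\mathbf{w})\in Z_\varepsilon$ for $\tau\in[0,T]$ (value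 $\infty$ if no such $\mathbf{w}$ exists; it is assumed that the minimum exists and is attained), and $V_0=0$.
   Formalization: The bound is stated only for initial states whose heading satisfies |θ₀ − arctan ρ'(λ₀)| ≤ 2π; since θ ranges over all of ℝ and is not taken modulo 2π, the claim for all z₀ ∈ Z_ε fails as θ₀ → ∞ once t exceeds the finite total integral of c. *)

theory Defs
  imports "HOL-Analysis.Analysis"
begin

text \<open>Robot pose \<open>(x, y, \<theta>)\<close>, augmented state \<open>((x, y, \<theta>), \<lambda>)\<close>, and input \<open>((v, \<omega>), g)\<close>.\<close>

type_synonym pose = "real \<times> real \<times> real"
type_synonym state = "pose \<times> real"
type_synonym input = "(real \<times> real) \<times> real"

record path_problem =
  x_max :: real
  y_max :: real
  v_max :: real
  \<omega>_max :: real
  g_max :: real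
  \<epsilon> :: real
  \<rho> :: "real \<Rightarrow> real"
  q\<^sub>1 :: real
  q\<^sub>2 :: real
  q\<^sub>3 :: real
  q_hat :: real
  r\<^sub>1 :: real
  r\<^sub>2 :: real
  r_hat :: real

definition lam_min :: "path_problem \<Rightarrow> real" where
  "lam_min P = - x_max P"

definition X :: "path_problem \<Rightarrow> real \<Rightarrow> pose set" where
  "X P e = {- x_max P .. - e} \<times> {- y_max P .. y_max P} \<times> UNIV"

definition U :: "path_problem \<Rightarrow> (real \<times> real) set" where
  "U P = {- v_max P .. v_max P} \<times> {- \<omega>_max P .. \<omega>_max P}"

definition W :: "path_problem \<Rightarrow> input set" where
  "W P = U P \<times> {0 .. g_max P}"

text \<open>The derivatives are taken within \<open>[lam_min, 0]\<close>, hence one-sided at the end points: \<open>\<rho>\<close> is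
  only constrained on that interval.\<close>

definition d\<rho> :: "path_problem \<Rightarrow> real \<Rightarrow> real" where
  "d\<rho> P l = vector_derivative (\<rho> P) (at l within {lam_min P .. 0})"

definition dd\<rho> :: "path_problem \<Rightarrow> real \<Rightarrow> real" where
  "dd\<rho> P l = vector_derivative (d\<rho> P) (at l within {lam_min P .. 0})"

definition ref_path :: "path_problem \<Rightarrow> real \<Rightarrow> pose" where
  "ref_path P l = (l, \<rho> P l, arctan (d\<rho> P l))"

definition Z :: "path_problem \<Rightarrow> state set" where
  "Z P = X P (\<epsilon> P) \<times> {lam_min P .. - \<epsilon> P} \<union> {(ref_path P l, l) | l. l \<in> {- \<epsilon> P <.. 0}}"

fun f\<^sub>g :: "state \<Rightarrow> input \<Rightarrow> state" where
  "f\<^sub>g ((x, y, \<theta>), l) ((v, \<omega>), g) = ((v * cos \<theta>, v * sin \<theta>, \<omega>), g)"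

text \<open>Finitely many discontinuities in every bounded part of \<open>I\<close>, and finite one-sided limits
  everywhere, including at the end points of \<open>I\<close> (a limit along the trivial filter always exists).\<close>

definition piecewise_continuous_on :: "real set \<Rightarrow> (real \<Rightarrow> 'a::topological_space) \<Rightarrow> bool" where
  "piecewise_continuous_on I f \<longleftrightarrow>
     (\<forall>a b. \<exists>S. finite S \<and> continuous_on (I \<inter> {a..b} - S) f) \<and>
     (\<forall>t \<in> closure I. (\<exists>l. (f \<longlongrightarrow> l) (at t within I \<inter> {..<t})) \<and>
                       (\<exists>l. (f \<longlongrightarrow> l) (at t within I \<inter> {t<..})))"

text \<open>\<open>z\<close> is the trajectory on \<open>[0, T]\<close> from \<open>z\<^sub>0\<close> under \<open>w\<close>. As \<open>w\<close> is only piecewise continuous,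
  the differential equation is required up to finitely many times; on \<open>[0, T]\<close> this determines \<open>z\<close>.\<close>

definition trajectory :: "state \<Rightarrow> (real \<Rightarrow> input) \<Rightarrow> real \<Rightarrow> (real \<Rightarrow> state) \<Rightarrow> bool" where
  "trajectory z\<^sub>0 w T z \<longleftrightarrow> z 0 = z\<^sub>0 \<and> continuous_on {0..T} z \<and>
     (\<exists>S. finite S \<and> (\<forall>t \<in> {0<..<T} - S. (z has_vector_derivative f\<^sub>g (z t) (w t)) (at t)))"

definition u_ref :: "path_problem \<Rightarrow> real \<Rightarrow> real \<Rightarrow> real \<times> real" where
  "u_ref P l g = (g * sqrt (1 + (d\<rho> P l)\<^sup>2), g * dd\<rho> P l / (1 + (d\<rho> P l)\<^sup>2))"

definition g_hat :: "path_problem \<Rightarrow> real" where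
  "g_hat P = (GREATEST g. g \<in> {0 .. g_max P} \<and> (\<forall>l \<in> {lam_min P .. 0}. u_ref P l g \<in> U P))"

text \<open>The heading is a real number and its deviation is not reduced modulo \<open>2\<pi>\<close>. An initial heading
  carrying arbitrarily many superfluous full turns would need arbitrarily long to unwind, whereas the
  bound has a horizon (\<open>4 t\<^sub>r\<close> of turning) that allows for one full turn only. Initial headings are
  therefore normalised by \<open>\<bar>heading_error\<bar> \<le> 2\<pi>\<close>; this covers both \<open>\<theta> \<in> [-\<pi>, \<pi>]\<close> and a deviation
  in \<open>[-\<pi>, \<pi>]\<close>, so every physical orientation has such a representative.\<close>

fun heading_error :: "path_problem \<Rightarrow> state \<Rightarrow> real" where
  "heading_error P ((x, y, \<theta>), l) = \<theta> - arctan (d\<rho> P l)"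

fun stage_cost :: "path_problem \<Rightarrow> state \<Rightarrow> input \<Rightarrow> real" where
  "stage_cost P ((x, y, \<theta>), l) ((v, \<omega>), g) =
     q\<^sub>1 P * (x - l)\<^sup>2 + q\<^sub>2 P * (y - \<rho> P l)\<^sup>2 + q\<^sub>3 P * (\<theta> - arctan (d\<rho> P l))\<^sup>2 + q_hat P * l\<^sup>2
     + r\<^sub>1 P * (v - fst (u_ref P l g))\<^sup>2 + r\<^sub>2 P * (\<omega> - snd (u_ref P l g))\<^sup>2 + r_hat P * g\<^sup>2"

definition min_stage_cost :: "path_problem \<Rightarrow> state \<Rightarrow> real" where
  "min_stage_cost P z = (LEAST c. c \<in> stage_cost P z ` W P)"

definition admissible ::
    "path_problem \<Rightarrow> real \<Rightarrow> state \<Rightarrow> (real \<Rightarrow> input) \<Rightarrow> (real \<Rightarrow> state) \<Rightarrow> bool" where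
  "admissible P T z\<^sub>0 w z \<longleftrightarrow>
     piecewise_continuous_on {0..<T} w \<and> (\<forall>\<tau> \<in> {0..<T}. w \<tau> \<in> W P) \<and>
     trajectory z\<^sub>0 w T z \<and> (\<forall>\<tau> \<in> {0..T}. z \<tau> \<in> Z P)"

text \<open>For admissible pairs and twice continuously differentiable \<open>\<rho>\<close> the integrand is bounded and
  piecewise continuous, so the default value of the integral is irrelevant.\<close>

definition total_cost :: "path_problem \<Rightarrow> real \<Rightarrow> (real \<Rightarrow> input) \<Rightarrow> (real \<Rightarrow> state) \<Rightarrow> real" where
  "total_cost P T w z = integral {0..T} (\<lambda>\<tau>. stage_cost P (z \<tau>) (w \<tau>))"

text \<open>An infimum in the extended reals, so that the value is \<open>\<infinity>\<close> if nothing is admissible.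
  That it is a minimum otherwise is the predicate \<open>value_attained\<close>.\<close>

definition V :: "path_problem \<Rightarrow> real \<Rightarrow> state \<Rightarrow> ereal" where
  "V P T z\<^sub>0 = (if T = 0 then 0
     else Inf {ereal (total_cost P T w z) | w z. admissible P T z\<^sub>0 w z})"

definition value_attained :: "path_problem \<Rightarrow> bool" where
  "value_attained P \<longleftrightarrow> (\<forall>T > 0. \<forall>z\<^sub>0. (\<exists>w z. admissible P T z\<^sub>0 w z) \<longrightarrow>
     (\<exists>w z. admissible P T z\<^sub>0 w z \<and> V P T z\<^sub>0 = ereal (total_cost P T w z)))"

definition t\<^sub>r :: "path_problem \<Rightarrow> real" where
  "t\<^sub>r P = (pi / 2) / \<omega>_max P"

definition t\<^sub>l :: "path_problem \<Rightarrow> real" where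
  "t\<^sub>l P = sqrt (4 * (y_max P)\<^sup>2 + (lam_min P + \<epsilon> P)\<^sup>2) / v_max P"

definition t\<^sub>g :: "path_problem \<Rightarrow> real" where
  "t\<^sub>g P = \<bar>lam_min P\<bar> / g_hat P"

definition c_fun :: "path_problem \<Rightarrow> real \<Rightarrow> real" where
  "c_fun P t =
    (if t \<in> {0 ..< t\<^sub>r P} then
       1 + q\<^sub>3 P * pi\<^sup>2 * (t\<^sup>2 + 6 * t\<^sub>r P * t + 1/2) / (4 * (t\<^sub>r P)\<^sup>2 * q_hat P * (\<epsilon> P)\<^sup>2)
     else if t \<in> {t\<^sub>r P ..< t\<^sub>r P + t\<^sub>l P} then
       1 + (q\<^sub>3 P * (3 * pi / 2)\<^sup>2 + r\<^sub>1 P * (v_max P)\<^sup>2) / (q_hat P * (\<epsilon> P)\<^sup>2)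
     else if t \<in> {t\<^sub>r P + t\<^sub>l P ..< 4 * t\<^sub>r P + t\<^sub>l P} then
       1 + q\<^sub>3 P * pi\<^sup>2 * ((4 * t\<^sub>r P + t\<^sub>l P - t)\<^sup>2 + 1/2) / (4 * (t\<^sub>r P)\<^sup>2 * q_hat P * (\<epsilon> P)\<^sup>2)
     else if t \<in> {4 * t\<^sub>r P + t\<^sub>l P ..< 4 * t\<^sub>r P + t\<^sub>l P + t\<^sub>g P} then
       ((4 * t\<^sub>r P + t\<^sub>l P + t\<^sub>g P - t)\<^sup>2 + r_hat P / q_hat P) / (t\<^sub>g P)\<^sup>2
     else 0)"

definition B_fun :: "path_problem \<Rightarrow> real \<Rightarrow> real" where
  "B_fun P t = min t (integral {0..t} (c_fun P))"

end

theory Submission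
  imports Defs
begin

text \<open>The value function is bounded by exhibiting an admissible input and computing its cost.

  At path speed \<open>g = 0\<close> the reference input vanishes, so the zero input minimises the stage cost:
  \<open>\<ell>\<^sup>*\<close> is the pure state cost (\<open>min_stage_cost_eq\<close>), and resting gives \<open>V\<^sub>t \<le> t \<ell>\<^sup>*\<close>. On the turning and
  driving phases of \<open>c\<close>, that is up to the time \<open>t_join = 4 t\<^sub>r + t\<^sub>l\<close>, one has \<open>c \<ge> 1\<close>. Hence
  resting also stays below \<open>\<ell>\<^sup>* \<integral>c\<close> for every horizon up to \<open>t_join\<close>. A manoeuvre that brings the robot
  onto the path is needed only for longer horizons; it has to meet the budget \<open>\<ell>\<^sup>* \<integral>c\<close> merely in total
  over \<open>[0, t_join]\<close>, and the time \<open>4 t\<^sub>r\<close> may be divided freely between its two turns.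

  The manoeuvre keeps \<open>\<lambda>\<close> fixed, turns on the spot towards \<open>p(\<lambda>)\<close>, drives there in a straight line, and
  turns into the heading of the path. Driving may be forwards or backwards, so the driving heading
  matters modulo \<open>\<pi>\<close> only. It can therefore be chosen such that both turns together cover at most
  \<open>2\<pi>\<close>, which at full rate takes the time \<open>4 t\<^sub>r\<close>, while the squared heading error never exceeds its
  initial value by more than \<open>\<pi>\<^sup>2/4\<close> (\<open>stopover_heading\<close>). In excess of \<open>\<ell>\<^sup>*\<close> the manoeuvre thus costs at
  most \<open>q\<^sub>3 \<pi>\<^sup>2/4 + r\<^sub>2 \<omega>_max\<^sup>2\<close> per unit of turning time and \<open>q\<^sub>3 \<pi>\<^sup>2/4 + r\<^sub>1 v_max\<^sup>2\<close> per unit of driving time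
  (\<open>steers_to_path\<close>). For \<open>\<lambda> \<le> - \<epsilon>\<close> one has \<open>\<ell>\<^sup>* \<ge> q_hat \<epsilon>\<^sup>2\<close>, so the integral of \<open>(c - 1) q_hat \<epsilon>\<^sup>2\<close> covers
  this excess (\<open>c_integral_join_ge\<close>); here \<open>r\<^sub>2 \<le> q\<^sub>3/2\<close> enters. A state on the path with
  \<open>\<lambda> > - \<epsilon>\<close> simply waits until \<open>t_join\<close>.

  From then on the path is followed at the constant speed that brings \<open>\<lambda>\<close> to \<open>0\<close> in time \<open>t\<^sub>g\<close>. The cost
  rate is exactly the last phase of \<open>c\<close> times \<open>q_hat \<lambda>\<^sup>2 \<le> \<ell>\<^sup>*\<close> (\<open>steers_along_path\<close>), and at the end of
  the path resting costs nothing.\<close>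

section \<open>Piecewise continuous functions and their integrals\<close>

text \<open>On \<open>{0..<T}\<close> a one-sided limit relative to the interval is either an ordinary one or taken along
  the trivial filter. Ordinary one-sided limits are easier to shift in time.\<close>

lemma piecewise_continuous_on_Ico_iff:
  fixes w :: "real \<Rightarrow> 'a::topological_space"
  shows "piecewise_continuous_on {0..<T} w \<longleftrightarrow>
    (\<exists>S. finite S \<and> continuous_on ({0..<T} - S) w) \<and>
    (\<forall>t. 0 < t \<and> t \<le> T \<longrightarrow> (\<exists>l. (w \<longlongrightarrow> l) (at_left t))) \<and>
    (\<forall>t. 0 \<le> t \<and> t < T \<longrightarrow> (\<exists>l. (w \<longlongrightarrow> l) (at_right t)))" (is "_ \<longleftrightarrow> ?rhs")
proof -
  have left: "at t within {0..<T} \<inter> {..<t} = at_left t" if "0 < t" "t \<le> T" for t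
    using that by (intro at_within_nhd[of _ "{0<..<t+1}"]) auto
  have right: "at t within {0..<T} \<inter> {t<..} = at_right t" if "0 \<le> t" "t < T" for t
    using that by (intro at_within_nhd[of _ "{..<T}"]) auto
  have left': "at t within {0..<T} \<inter> {..<t} = bot" if "t \<le> 0" for t
  proof -
    have e: "{0..<T} \<inter> {..<t} = {}" using that by auto
    show ?thesis unfolding e by simp
  qed
  have right': "at t within {0..<T} \<inter> {t<..} = bot" if "T \<le> t" for t
  proof -
    have e: "{0..<T} \<inter> {t<..} = {}" using that by auto
    show ?thesis unfolding e by simp
  qed
  have cl: "t \<in> closure {0..<T} \<longleftrightarrow> 0 \<le> t \<and> t \<le> T \<and> 0 < T" for t
    by (cases "0 < T") auto
  have cont: "(\<forall>a b. \<exists>S. finite S \<and> continuous_on ({0..<T} \<inter> {a..b} - S) w) \<longleftrightarrow>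
      (\<exists>S. finite S \<and> continuous_on ({0..<T} - S) w)"
  proof
    assume "\<forall>a b. \<exists>S. finite S \<and> continuous_on ({0..<T} \<inter> {a..b} - S) w"
    then obtain S where "finite S" "continuous_on ({0..<T} \<inter> {0..T} - S) w" by blast
    moreover have "{0..<T} \<inter> {0..T} = {0..<T}" by auto
    ultimately show "\<exists>S. finite S \<and> continuous_on ({0..<T} - S) w" by auto
  next
    assume "\<exists>S. finite S \<and> continuous_on ({0..<T} - S) w"
    then obtain S where "finite S" "continuous_on ({0..<T} - S) w" by blast
    then show "\<forall>a b. \<exists>S. finite S \<and> continuous_on ({0..<T} \<inter> {a..b} - S) w"
      by (meson Diff_mono Int_lower1 continuous_on_subset subset_refl)
  qed
  have lims: "(\<forall>t\<in>closure {0..<T}. (\<exists>l. (w \<longlongrightarrow> l) (at t within {0..<T} \<inter> {..<t})) \<and>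
                 (\<exists>l. (w \<longlongrightarrow> l) (at t within {0..<T} \<inter> {t<..}))) \<longleftrightarrow>
    (\<forall>t. 0 < t \<and> t \<le> T \<longrightarrow> (\<exists>l. (w \<longlongrightarrow> l) (at_left t))) \<and>
    (\<forall>t. 0 \<le> t \<and> t < T \<longrightarrow> (\<exists>l. (w \<longlongrightarrow> l) (at_right t)))" (is "?L \<longleftrightarrow> ?R")
  proof
    assume L: ?L
    show ?R
    proof (intro conjI allI impI)
      fix t assume t: "0 < t \<and> t \<le> T"
      then show "\<exists>l. (w \<longlongrightarrow> l) (at_left t)" using bspec[OF L, of t] left[of t] cl[of t] by auto
    next
      fix t assume t: "0 \<le> t \<and> t < T"
      then show "\<exists>l. (w \<longlongrightarrow> l) (at_right t)" using bspec[OF L, of t] right[of t] cl[of t] by auto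
    qed
  next
    assume R: ?R
    show ?L
    proof (intro ballI conjI)
      fix t assume t: "t \<in> closure {0..<T}"
      show "\<exists>l. (w \<longlongrightarrow> l) (at t within {0..<T} \<inter> {..<t})"
      proof (cases "0 < t")
        case True then show ?thesis using R t cl left by metis
      next
        case False then show ?thesis using left'[of t] by (simp add: tendsto_bot)
      qed
      show "\<exists>l. (w \<longlongrightarrow> l) (at t within {0..<T} \<inter> {t<..})"
      proof (cases "t < T")
        case True then show ?thesis using R t cl right by metis
      next
        case False then show ?thesis using right'[of t] by (simp add: tendsto_bot)
      qed
    qed
  qed
  show ?thesis unfolding piecewise_continuous_on_def cont lims ..
qed

lemma continuous_on_imp_piecewise_continuous_on:
  assumes "continuous_on I f" "closed I"
  shows "piecewise_continuous_on I f"
  unfolding piecewise_continuous_on_def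
proof (intro conjI allI ballI)
  fix a b :: real
  show "\<exists>S. finite S \<and> continuous_on (I \<inter> {a..b} - S) f"
    using assms(1) by (intro exI[of _ "{}"]) (auto intro: continuous_on_subset)
next
  fix t assume "t \<in> closure I"
  then have "(f \<longlongrightarrow> f t) (at t within I)"
    using assms by (simp add: continuous_on_def)
  then show "\<exists>l. (f \<longlongrightarrow> l) (at t within I \<inter> {..<t})" "\<exists>l. (f \<longlongrightarrow> l) (at t within I \<inter> {t<..})"
    by (meson Int_lower1 tendsto_within_subset)+
qed

lemma continuous_on_Icc_imp_piecewise_continuous_on_Ico:
  assumes "continuous_on {0..T} w"
  shows "piecewise_continuous_on {0..<T} w"
  unfolding piecewise_continuous_on_Ico_iff
proof (intro conjI allI impI)
  show "\<exists>S. finite S \<and> continuous_on ({0..<T} - S) w"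
    using assms by (intro exI[of _ "{}"]) (auto intro: continuous_on_subset)
next
  fix t assume t: "0 < t \<and> t \<le> T"
  have "(w \<longlongrightarrow> w t) (at t within {0..T})" using assms t by (simp add: continuous_on_def)
  then have "(w \<longlongrightarrow> w t) (at t within {0..t})" by (rule tendsto_within_subset) (use t in auto)
  then show "\<exists>l. (w \<longlongrightarrow> l) (at_left t)" using t by (auto simp: at_within_Icc_at_left)
next
  fix t assume t: "0 \<le> t \<and> t < T"
  have "(w \<longlongrightarrow> w t) (at t within {0..T})" using assms t by (simp add: continuous_on_def)
  then have "(w \<longlongrightarrow> w t) (at t within {t..T})" by (rule tendsto_within_subset) (use t in auto)
  then show "\<exists>l. (w \<longlongrightarrow> l) (at_right t)" using t by (auto simp: at_within_Icc_at_right)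
qed

lemma filterlim_minus_const_at_left:
  "filterlim (\<lambda>t. t - c) (at_left (a - c)) (at_left (a::real))"
  unfolding filterlim_at by (auto intro!: tendsto_intros simp: eventually_at_filter)

lemma filterlim_minus_const_at_right:
  "filterlim (\<lambda>t. t - c) (at_right (a - c)) (at_right (a::real))"
  unfolding filterlim_at by (auto intro!: tendsto_intros simp: eventually_at_filter)

text \<open>At the junction the left limit comes from the first function and the right limit from the
  second one; the junction itself joins the finite set of possible discontinuities.\<close>

lemma piecewise_continuous_on_append:
  fixes w\<^sub>1 w\<^sub>2 :: "real \<Rightarrow> 'a::topological_space"
  assumes "0 \<le> T\<^sub>1" "0 \<le> T\<^sub>2"
    and w1: "piecewise_continuous_on {0..<T\<^sub>1} w\<^sub>1" and w2: "piecewise_continuous_on {0..<T\<^sub>2} w\<^sub>2"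
  shows "piecewise_continuous_on {0..<T\<^sub>1 + T\<^sub>2} (\<lambda>t. if t < T\<^sub>1 then w\<^sub>1 t else w\<^sub>2 (t - T\<^sub>1))"
    (is "piecewise_continuous_on _ ?w")
proof -
  obtain S1 S2 where S: "finite S1" "continuous_on ({0..<T\<^sub>1} - S1) w\<^sub>1"
    "finite S2" "continuous_on ({0..<T\<^sub>2} - S2) w\<^sub>2"
    using w1 w2 unfolding piecewise_continuous_on_Ico_iff by blast
  let ?S = "insert T\<^sub>1 (S1 \<union> (\<lambda>t. t + T\<^sub>1) ` S2)"
  let ?D = "{0..<T\<^sub>1 + T\<^sub>2} - ?S"
  have D: "?D = ?D \<inter> {..<T\<^sub>1} \<union> ?D \<inter> {T\<^sub>1<..}" by auto
  have c1: "continuous_on (?D \<inter> {..<T\<^sub>1}) ?w"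
  proof (rule continuous_on_eq)
    show "continuous_on (?D \<inter> {..<T\<^sub>1}) w\<^sub>1"
      using S(2) by (rule continuous_on_subset) auto
  qed auto
  have c2: "continuous_on (?D \<inter> {T\<^sub>1<..}) ?w"
  proof (rule continuous_on_eq)
    show "continuous_on (?D \<inter> {T\<^sub>1<..}) (\<lambda>t. w\<^sub>2 (t - T\<^sub>1))"
    proof (rule continuous_on_compose2[OF S(4)])
      show "(\<lambda>t. t - T\<^sub>1) ` (?D \<inter> {T\<^sub>1<..}) \<subseteq> {0..<T\<^sub>2} - S2"
        by (force simp: image_iff)
    qed (intro continuous_intros)
  qed auto
  have "openin (top_of_set ?D) (?D \<inter> {..<T\<^sub>1})" "openin (top_of_set ?D) (?D \<inter> {T\<^sub>1<..})"
    by (simp_all add: openin_open_Int)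
  then have "continuous_on (?D \<inter> {..<T\<^sub>1} \<union> ?D \<inter> {T\<^sub>1<..}) ?w"
    using c1 c2 by (intro continuous_on_Un_local_open) (simp_all only: D[symmetric])
  then have cont: "continuous_on ?D ?w" by (simp only: D[symmetric])
  show ?thesis
    unfolding piecewise_continuous_on_Ico_iff
  proof (intro conjI allI impI)
    show "\<exists>S. finite S \<and> continuous_on ({0..<T\<^sub>1 + T\<^sub>2} - S) ?w"
      using cont S(1,3) by (intro exI[of _ ?S]) auto
  next
    fix t assume t: "0 < t \<and> t \<le> T\<^sub>1 + T\<^sub>2"
    show "\<exists>l. (?w \<longlongrightarrow> l) (at_left t)"
    proof (cases "t \<le> T\<^sub>1")
      case True
      then obtain l where "(w\<^sub>1 \<longlongrightarrow> l) (at_left t)"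
        using w1 t unfolding piecewise_continuous_on_Ico_iff by blast
      moreover have "\<forall>\<^sub>F s in at_left t. w\<^sub>1 s = ?w s"
        using True by (auto simp: eventually_at_filter)
      ultimately show ?thesis by (intro exI) (rule Lim_transform_eventually)
    next
      case False
      then have "0 < t - T\<^sub>1 \<and> t - T\<^sub>1 \<le> T\<^sub>2" using t by auto
      then obtain l where "(w\<^sub>2 \<longlongrightarrow> l) (at_left (t - T\<^sub>1))"
        using w2 unfolding piecewise_continuous_on_Ico_iff by blast
      then have "((\<lambda>s. w\<^sub>2 (s - T\<^sub>1)) \<longlongrightarrow> l) (at_left t)"
        by (rule filterlim_compose) (rule filterlim_minus_const_at_left)
      moreover have "\<forall>\<^sub>F s in at_left t. s \<in> {T\<^sub>1<..<t}"
        using False by (intro eventually_at_left_real) auto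
      then have "\<forall>\<^sub>F s in at_left t. w\<^sub>2 (s - T\<^sub>1) = ?w s"
        by (rule eventually_mono) auto
      ultimately show ?thesis by (intro exI) (rule Lim_transform_eventually)
    qed
  next
    fix t assume t: "0 \<le> t \<and> t < T\<^sub>1 + T\<^sub>2"
    show "\<exists>l. (?w \<longlongrightarrow> l) (at_right t)"
    proof (cases "t < T\<^sub>1")
      case True
      then obtain l where "(w\<^sub>1 \<longlongrightarrow> l) (at_right t)"
        using w1 t unfolding piecewise_continuous_on_Ico_iff by blast
      moreover have "\<forall>\<^sub>F s in at_right t. s \<in> {t<..<T\<^sub>1}"
        using True by (intro eventually_at_right_real) auto
      then have "\<forall>\<^sub>F s in at_right t. w\<^sub>1 s = ?w s"
        by (rule eventually_mono) auto
      ultimately show ?thesis by (intro exI) (rule Lim_transform_eventually)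
    next
      case False
      then have "0 \<le> t - T\<^sub>1 \<and> t - T\<^sub>1 < T\<^sub>2" using t by auto
      then obtain l where "(w\<^sub>2 \<longlongrightarrow> l) (at_right (t - T\<^sub>1))"
        using w2 unfolding piecewise_continuous_on_Ico_iff by blast
      then have "((\<lambda>s. w\<^sub>2 (s - T\<^sub>1)) \<longlongrightarrow> l) (at_right t)"
        by (rule filterlim_compose) (rule filterlim_minus_const_at_right)
      moreover have "\<forall>\<^sub>F s in at_right t. w\<^sub>2 (s - T\<^sub>1) = ?w s"
        using False by (auto simp: eventually_at_filter)
      ultimately show ?thesis by (intro exI) (rule Lim_transform_eventually)
    qed
  qed
qed

text \<open>The right end point is a null set, so a jump of \<open>h\<close> there does not matter.\<close>

lemma has_integral_continuous_Ico:
  fixes f h :: "real \<Rightarrow> real"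
  assumes "continuous_on {a..b} f" "\<And>t. a \<le> t \<Longrightarrow> t < b \<Longrightarrow> h t = f t"
  shows "(h has_integral integral {a..b} f) {a..b}"
proof (rule has_integral_spike_finite[of "{b}"])
  show "(f has_integral integral {a..b} f) {a..b}"
    using assms(1) by (intro integrable_integral integrable_continuous_interval)
qed (use assms in auto)

section \<open>Steering with bounded cost\<close>

text \<open>The bound refers to an existing integral, not to the value of \<open>total_cost\<close> alone: the
  default value of the integral of a non-integrable function would spoil the additivity of costs
  under concatenation.\<close>

definition steers :: "path_problem \<Rightarrow> state \<Rightarrow> real \<Rightarrow> state \<Rightarrow> real \<Rightarrow> bool" where
  "steers P z\<^sub>0 T z\<^sub>1 C \<longleftrightarrow> 0 \<le> T \<and> (\<exists>w z c. admissible P T z\<^sub>0 w z \<and> z T = z\<^sub>1 \<and>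
     ((\<lambda>\<tau>. stage_cost P (z \<tau>) (w \<tau>)) has_integral c) {0..T} \<and> c \<le> C)"

lemma steers_mono: "steers P z\<^sub>0 T z\<^sub>1 C \<Longrightarrow> C \<le> C' \<Longrightarrow> steers P z\<^sub>0 T z\<^sub>1 C'"
  unfolding steers_def by (blast intro: order_trans)

lemma V_le_if_steers:
  assumes "steers P z\<^sub>0 T z\<^sub>1 C" "0 < T"
  shows "V P T z\<^sub>0 \<le> ereal C"
proof -
  obtain w z c where wz: "admissible P T z\<^sub>0 w z"
    "((\<lambda>\<tau>. stage_cost P (z \<tau>) (w \<tau>)) has_integral c) {0..T}" "c \<le> C"
    using assms(1) unfolding steers_def by blast
  then have "total_cost P T w z = c"
    unfolding total_cost_def by (simp add: integral_unique)
  then have "Inf {ereal (total_cost P T w z) | w z. admissible P T z\<^sub>0 w z} \<le> ereal c"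
    using wz(1) by (intro Inf_lower) auto
  also have "\<dots> \<le> ereal C" using wz(3) by simp
  finally show ?thesis using assms(2) by (simp add: V_def)
qed

lemma steers_arc:
  assumes "0 \<le> T" "continuous_on {0..T} w" "z 0 = z\<^sub>0" "z T = z\<^sub>1"
    and W: "\<And>\<tau>. 0 \<le> \<tau> \<Longrightarrow> \<tau> \<le> T \<Longrightarrow> w \<tau> \<in> W P"
    and Z: "\<And>\<tau>. 0 \<le> \<tau> \<Longrightarrow> \<tau> \<le> T \<Longrightarrow> z \<tau> \<in> Z P"
    and z': "\<And>\<tau>. 0 \<le> \<tau> \<Longrightarrow> \<tau> \<le> T \<Longrightarrow>
      (z has_vector_derivative f\<^sub>g (z \<tau>) (w \<tau>)) (at \<tau> within {0..T})"
    and cost: "((\<lambda>\<tau>. stage_cost P (z \<tau>) (w \<tau>)) has_integral c) {0..T}" "c \<le> C"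
  shows "steers P z\<^sub>0 T z\<^sub>1 C"
proof -
  have "trajectory z\<^sub>0 w T z"
    unfolding trajectory_def
  proof (intro conjI exI[of _ "{}"] ballI)
    show "continuous_on {0..T} z"
      unfolding continuous_on_eq_continuous_within
      using z' by (meson atLeastAtMost_iff has_vector_derivative_continuous)
    fix t assume t: "t \<in> {0<..<T} - {}"
    then have "at t within {0..T} = at t" by (intro at_within_interior) auto
    then show "(z has_vector_derivative f\<^sub>g (z t) (w t)) (at t)" using z'[of t] t by auto
  qed (use assms in auto)
  then have "admissible P T z\<^sub>0 w z"
    unfolding admissible_def
    using continuous_on_Icc_imp_piecewise_continuous_on_Ico assms by force
  then show ?thesis unfolding steers_def using assms by blast
qed

text \<open>The dynamics and the stage cost do not depend on time, so the second arc may be run with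
  delay \<open>T\<^sub>1\<close>.\<close>

lemma steers_trans:
  assumes st1: "steers P z\<^sub>0 T\<^sub>1 z\<^sub>1 C\<^sub>1" and st2: "steers P z\<^sub>1 T\<^sub>2 z\<^sub>2 C\<^sub>2"
  shows "steers P z\<^sub>0 (T\<^sub>1 + T\<^sub>2) z\<^sub>2 (C\<^sub>1 + C\<^sub>2)"
proof -
  obtain w1 y1 c1 where 1: "0 \<le> T\<^sub>1" "admissible P T\<^sub>1 z\<^sub>0 w1 y1" "y1 T\<^sub>1 = z\<^sub>1" "c1 \<le> C\<^sub>1"
    "((\<lambda>\<tau>. stage_cost P (y1 \<tau>) (w1 \<tau>)) has_integral c1) {0..T\<^sub>1}"
    using st1 unfolding steers_def by blast
  obtain w2 y2 c2 where 2: "0 \<le> T\<^sub>2" "admissible P T\<^sub>2 z\<^sub>1 w2 y2" "y2 T\<^sub>2 = z\<^sub>2" "c2 \<le> C\<^sub>2"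
    "((\<lambda>\<tau>. stage_cost P (y2 \<tau>) (w2 \<tau>)) has_integral c2) {0..T\<^sub>2}"
    using st2 unfolding steers_def by blast
  define w where "w = (\<lambda>t. if t < T\<^sub>1 then w1 t else w2 (t - T\<^sub>1))"
  define z where "z = (\<lambda>t. if t \<le> T\<^sub>1 then y1 t else y2 (t - T\<^sub>1))"
  have y2_0: "y2 0 = z\<^sub>1" and y1_0: "y1 0 = z\<^sub>0"
    using 1 2 by (auto simp: admissible_def trajectory_def)
  have z_late: "z t = y2 (t - T\<^sub>1)" if "T\<^sub>1 \<le> t" for t
    using that 1(3) y2_0 by (auto simp: z_def)
  have "admissible P (T\<^sub>1 + T\<^sub>2) z\<^sub>0 w z"
    unfolding admissible_def
  proof (intro conjI ballI)
    show "piecewise_continuous_on {0..<T\<^sub>1 + T\<^sub>2} w"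
      unfolding w_def using 1 2 by (intro piecewise_continuous_on_append) (auto simp: admissible_def)
    show "w \<tau> \<in> W P" if "\<tau> \<in> {0..<T\<^sub>1 + T\<^sub>2}" for \<tau>
      using that 1 2 by (auto simp: w_def admissible_def)
    show "z \<tau> \<in> Z P" if "\<tau> \<in> {0..T\<^sub>1 + T\<^sub>2}" for \<tau>
      using that 1 2 by (auto simp: z_def admissible_def)
    show "trajectory z\<^sub>0 w (T\<^sub>1 + T\<^sub>2) z"
      unfolding trajectory_def
    proof (intro conjI)
      show "z 0 = z\<^sub>0" using 1(1) y1_0 by (simp add: z_def)
      have cont1: "continuous_on {0..T\<^sub>1} y1" and cont2: "continuous_on {0..T\<^sub>2} y2"
        using 1 2 by (auto simp: admissible_def trajectory_def)
      have "continuous_on ({0..T\<^sub>1} \<union> {T\<^sub>1..T\<^sub>1 + T\<^sub>2}) z"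
      proof (rule continuous_on_closed_Un)
        show "continuous_on {0..T\<^sub>1} z"
          using cont1 by (rule continuous_on_eq) (auto simp: z_def)
        have "continuous_on {T\<^sub>1..T\<^sub>1 + T\<^sub>2} (\<lambda>t. y2 (t - T\<^sub>1))"
          by (rule continuous_on_compose2[OF cont2]) (auto intro!: continuous_intros)
        then show "continuous_on {T\<^sub>1..T\<^sub>1 + T\<^sub>2} z"
          by (rule continuous_on_eq) (auto simp: z_late)
      qed auto
      moreover have "{0..T\<^sub>1} \<union> {T\<^sub>1..T\<^sub>1 + T\<^sub>2} = {0..T\<^sub>1 + T\<^sub>2}" using 1(1) 2(1) by auto
      ultimately show "continuous_on {0..T\<^sub>1 + T\<^sub>2} z" by simp
      obtain S1 where S1: "finite S1"
        "\<And>t. t \<in> {0<..<T\<^sub>1} - S1 \<Longrightarrow> (y1 has_vector_derivative f\<^sub>g (y1 t) (w1 t)) (at t)"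
        using 1(2) unfolding admissible_def trajectory_def by blast
      obtain S2 where S2: "finite S2"
        "\<And>t. t \<in> {0<..<T\<^sub>2} - S2 \<Longrightarrow> (y2 has_vector_derivative f\<^sub>g (y2 t) (w2 t)) (at t)"
        using 2(2) unfolding admissible_def trajectory_def by blast
      let ?S = "insert T\<^sub>1 (S1 \<union> (\<lambda>t. t + T\<^sub>1) ` S2)"
      have "(z has_vector_derivative f\<^sub>g (z t) (w t)) (at t)"
        if t: "t \<in> {0<..<T\<^sub>1 + T\<^sub>2} - ?S" for t
      proof (cases "t < T\<^sub>1")
        case True
        have "(y1 has_vector_derivative f\<^sub>g (y1 t) (w1 t)) (at t)" using S1(2) t True by auto
        then have "(z has_vector_derivative f\<^sub>g (y1 t) (w1 t)) (at t)"
          by (rule has_vector_derivative_transform_within_open[where S = "{..<T\<^sub>1}"])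
             (use True in \<open>auto simp: z_def\<close>)
        then show ?thesis using True by (simp add: z_def w_def)
      next
        case False
        have "t - T\<^sub>1 \<notin> S2"
          using t by (force simp: image_iff)
        then have "(y2 has_vector_derivative f\<^sub>g (y2 (t - T\<^sub>1)) (w2 (t - T\<^sub>1))) (at (t - T\<^sub>1))"
          using S2(2)[of "t - T\<^sub>1"] t False by auto
        moreover have "((\<lambda>t. t - T\<^sub>1) has_vector_derivative 1) (at t)"
          by (auto intro!: derivative_eq_intros)
        ultimately have "(y2 \<circ> (\<lambda>t. t - T\<^sub>1) has_vector_derivative
            1 *\<^sub>R f\<^sub>g (y2 (t - T\<^sub>1)) (w2 (t - T\<^sub>1))) (at t)"
          by (intro vector_diff_chain_at) auto
        then have "(z has_vector_derivative 1 *\<^sub>R f\<^sub>g (y2 (t - T\<^sub>1)) (w2 (t - T\<^sub>1))) (at t)"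
          by (rule has_vector_derivative_transform_within_open[where S = "{T\<^sub>1<..}"])
             (use False t in \<open>auto simp: z_def\<close>)
        then show ?thesis using False t by (simp add: z_def w_def)
      qed
      then show "\<exists>S. finite S \<and> (\<forall>t\<in>{0<..<T\<^sub>1 + T\<^sub>2} - S.
          (z has_vector_derivative f\<^sub>g (z t) (w t)) (at t))"
        using S1(1) S2(1) by (intro exI[of _ ?S]) auto
    qed
  qed
  moreover have "z (T\<^sub>1 + T\<^sub>2) = z\<^sub>2" using z_late[of "T\<^sub>1 + T\<^sub>2"] 2 by simp
  moreover have "((\<lambda>\<tau>. stage_cost P (z \<tau>) (w \<tau>)) has_integral c1 + c2) {0..T\<^sub>1 + T\<^sub>2}"
  proof (rule has_integral_combine)
    show "((\<lambda>\<tau>. stage_cost P (z \<tau>) (w \<tau>)) has_integral c1) {0..T\<^sub>1}"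
      by (rule has_integral_spike_finite[OF _ _ 1(5), of "{T\<^sub>1}"]) (auto simp: z_def w_def)
    have "((\<lambda>\<tau>. stage_cost P (y2 (\<tau> - T\<^sub>1)) (w2 (\<tau> - T\<^sub>1))) has_integral c2) {T\<^sub>1..T\<^sub>1 + T\<^sub>2}"
      using has_integral_shift_real_ivl[OF 2(5), of "- T\<^sub>1"] by (simp add: add.commute)
    then show "((\<lambda>\<tau>. stage_cost P (z \<tau>) (w \<tau>)) has_integral c2) {T\<^sub>1..T\<^sub>1 + T\<^sub>2}"
      by (rule has_integral_eq[rotated]) (auto simp: z_late w_def)
  qed (use 1 2 in auto)
  ultimately show ?thesis
    unfolding steers_def using 1 2 by (intro conjI exI[of _ w] exI[of _ z] exI[of _ "c1 + c2"]) auto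
qed

lemma steers_arc_le:
  assumes "0 \<le> T" "continuous_on {0..T} w" "z 0 = z\<^sub>0" "z T = z\<^sub>1"
    and "\<And>\<tau>. 0 \<le> \<tau> \<Longrightarrow> \<tau> \<le> T \<Longrightarrow> w \<tau> \<in> W P"
    and "\<And>\<tau>. 0 \<le> \<tau> \<Longrightarrow> \<tau> \<le> T \<Longrightarrow> z \<tau> \<in> Z P"
    and "\<And>\<tau>. 0 \<le> \<tau> \<Longrightarrow> \<tau> \<le> T \<Longrightarrow>
      (z has_vector_derivative f\<^sub>g (z \<tau>) (w \<tau>)) (at \<tau> within {0..T})"
    and cont: "continuous_on {0..T} (\<lambda>\<tau>. stage_cost P (z \<tau>) (w \<tau>))"
    and le: "\<And>\<tau>. 0 \<le> \<tau> \<Longrightarrow> \<tau> \<le> T \<Longrightarrow> stage_cost P (z \<tau>) (w \<tau>) \<le> M"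
  shows "steers P z\<^sub>0 T z\<^sub>1 (T * M)"
proof (rule steers_arc[of T w z])
  have int: "(\<lambda>\<tau>. stage_cost P (z \<tau>) (w \<tau>)) integrable_on {0..T}"
    using cont by (rule integrable_continuous_interval)
  then show "((\<lambda>\<tau>. stage_cost P (z \<tau>) (w \<tau>)) has_integral
      integral {0..T} (\<lambda>\<tau>. stage_cost P (z \<tau>) (w \<tau>))) {0..T}"
    by (rule integrable_integral)
  have "integral {0..T} (\<lambda>\<tau>. stage_cost P (z \<tau>) (w \<tau>)) \<le> integral {0..T} (\<lambda>\<tau>. M)"
    using int le by (intro integral_le) auto
  then show "integral {0..T} (\<lambda>\<tau>. stage_cost P (z \<tau>) (w \<tau>)) \<le> T * M"
    using assms(1) by simp
qed (use assms in auto)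

section \<open>Geometry of turning and driving\<close>

text \<open>Every half turn of directions contains one that is parallel to a given vector, because
  \<open>a sin \<phi> - b cos \<phi>\<close> changes its sign over a half turn. The sign of \<open>d\<close> tells whether the vector is
  travelled forwards or backwards.\<close>

lemma signed_polar_in_half_turn:
  fixes a b c :: real
  obtains \<phi> d where "c \<le> \<phi>" "\<phi> \<le> c + pi" "a = d * cos \<phi>" "b = d * sin \<phi>" "d\<^sup>2 = a\<^sup>2 + b\<^sup>2"
proof -
  let ?f = "\<lambda>\<phi>. a * sin \<phi> - b * cos \<phi>"
  have flip: "?f (c + pi) = - ?f c" by simp
  have cont: "continuous_on {c..c + pi} ?f" by (intro continuous_intros)
  have "\<exists>\<phi>. c \<le> \<phi> \<and> \<phi> \<le> c + pi \<and> ?f \<phi> = 0"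
  proof (cases "?f c \<le> 0")
    case True
    then show ?thesis using flip cont by (intro IVT') auto
  next
    case False
    then show ?thesis using flip cont by (intro IVT2') auto
  qed
  then obtain \<phi> where \<phi>: "c \<le> \<phi>" "\<phi> \<le> c + pi" "a * sin \<phi> = b * cos \<phi>" by auto
  define d where "d = a * cos \<phi> + b * sin \<phi>"
  have "d * cos \<phi> = a * (cos \<phi>)\<^sup>2 + (b * cos \<phi>) * sin \<phi>"
    by (simp add: d_def algebra_simps power2_eq_square)
  also have "\<dots> = a * ((cos \<phi>)\<^sup>2 + (sin \<phi>)\<^sup>2)"
    unfolding \<phi>(3)[symmetric] by algebra
  finally have a: "a = d * cos \<phi>" by simp
  have "d * sin \<phi> = (a * sin \<phi>) * cos \<phi> + b * (sin \<phi>)\<^sup>2"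
    by (simp add: d_def algebra_simps power2_eq_square)
  also have "\<dots> = b * ((cos \<phi>)\<^sup>2 + (sin \<phi>)\<^sup>2)"
    unfolding \<phi>(3) by algebra
  finally have b: "b = d * sin \<phi>" by simp
  have "a\<^sup>2 + b\<^sup>2 = d\<^sup>2 * ((cos \<phi>)\<^sup>2 + (sin \<phi>)\<^sup>2)"
    unfolding a b by algebra
  then have "d\<^sup>2 = a\<^sup>2 + b\<^sup>2" by simp
  then show ?thesis by (rule that[OF \<phi>(1,2) a b])
qed

text \<open>Here \<open>\<psi>\<close> is the final heading, \<open>e\<close> the initial deviation from it and \<open>\<beta>\<close> the deviation while
  driving along \<open>(a, b)\<close>. If \<open>\<bar>e\<bar> > \<pi>\<close>, a suitable \<open>\<beta>\<close> lies between \<open>e\<close> and \<open>0\<close>, so the two turns have the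
  same sense and cover \<open>\<bar>e\<bar>\<close>. Otherwise a \<open>\<beta>\<close> with \<open>\<bar>\<beta>\<bar> \<le> \<pi>/2\<close> makes a detour of at most \<open>2 \<bar>\<beta>\<bar> \<le> \<pi>\<close>.\<close>

lemma stopover_heading:
  fixes e a b \<psi> :: real
  assumes "\<bar>e\<bar> \<le> 2 * pi"
  obtains \<beta> d where "a = d * cos (\<psi> + \<beta>)" "b = d * sin (\<psi> + \<beta>)" "d\<^sup>2 = a\<^sup>2 + b\<^sup>2"
    "\<bar>\<beta> - e\<bar> + \<bar>\<beta>\<bar> \<le> 2 * pi" "\<beta>\<^sup>2 \<le> e\<^sup>2 + pi\<^sup>2 / 4"
proof -
  define c where "c = (if e > pi then 0 else if e < - pi then - pi else - pi / 2)"
  obtain \<phi> d where \<phi>: "\<psi> + c \<le> \<phi>" "\<phi> \<le> \<psi> + c + pi"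
    "a = d * cos \<phi>" "b = d * sin \<phi>" "d\<^sup>2 = a\<^sup>2 + b\<^sup>2"
    by (rule signed_polar_in_half_turn)
  define \<beta> where "\<beta> = \<phi> - \<psi>"
  have \<beta>: "c \<le> \<beta>" "\<beta> \<le> c + pi" using \<phi> by (auto simp: \<beta>_def)
  have "\<bar>\<beta> - e\<bar> + \<bar>\<beta>\<bar> \<le> 2 * pi"
    using \<beta> assms by (auto simp: c_def abs_if split: if_splits)
  moreover have "\<beta>\<^sup>2 \<le> e\<^sup>2 + pi\<^sup>2 / 4"
  proof (cases "\<bar>e\<bar> \<le> pi")
    case True
    then have "\<bar>\<beta>\<bar> \<le> \<bar>pi / 2\<bar>" using \<beta> by (auto simp: c_def split: if_splits)
    then have "\<beta>\<^sup>2 \<le> (pi / 2)\<^sup>2" using abs_le_square_iff by blast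
    then have "\<beta>\<^sup>2 \<le> pi\<^sup>2 / 4" by (simp add: power_divide)
    then show ?thesis using zero_le_power2[of e] by linarith
  next
    case False
    then have "\<bar>\<beta>\<bar> \<le> \<bar>e\<bar>" using \<beta> by (auto simp: c_def split: if_splits)
    then have "\<beta>\<^sup>2 \<le> e\<^sup>2" using abs_le_square_iff by blast
    then show ?thesis using zero_le_power2[of pi] by linarith
  qed
  ultimately show ?thesis using that[of d \<beta>] \<phi> by (simp add: \<beta>_def)
qed

lemma abs_convex_combination_le:
  fixes a b m u :: real
  assumes "\<bar>a\<bar> \<le> m" "\<bar>b\<bar> \<le> m" "0 \<le> u" "u \<le> 1"
  shows "\<bar>(1 - u) * a + u * b\<bar> \<le> m"
proof -
  have "\<bar>(1 - u) * a + u * b\<bar> \<le> (1 - u) * \<bar>a\<bar> + u * \<bar>b\<bar>"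
    using assms by (intro order.trans[OF abs_triangle_ineq]) (simp add: abs_mult)
  also have "\<dots> \<le> (1 - u) * m + u * m"
    using assms by (intro add_mono mult_left_mono) auto
  finally show ?thesis by (simp add: algebra_simps)
qed

section \<open>The path following problem\<close>

locale path_following =
  fixes P :: path_problem
  assumes pos: "x_max P > 0" "y_max P > 0" "v_max P > 0" "\<omega>_max P > 0" "g_max P > 0"
    and eps: "0 < \<epsilon> P" "\<epsilon> P < x_max P"
    and \<rho>_diff: "\<rho> P differentiable_on {lam_min P .. 0}"
    and d\<rho>_diff: "d\<rho> P differentiable_on {lam_min P .. 0}"
    and dd\<rho>_cont: "continuous_on {lam_min P .. 0} (dd\<rho> P)"
    and path_in_X: "ref_path P ` {lam_min P .. 0} \<subseteq> X P 0"
    and cost_pos: "q\<^sub>1 P > 0" "q\<^sub>2 P > 0" "q\<^sub>3 P > 0" "q_hat P > 0"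
      "r\<^sub>1 P > 0" "r\<^sub>2 P > 0" "r_hat P > 0"
    and r2_le: "r\<^sub>2 P \<le> q\<^sub>3 P / 2"
begin

lemma lam_min_less: "lam_min P < - \<epsilon> P" "lam_min P < 0"
  using eps by (auto simp: lam_min_def)

lemma \<rho>_bounds: "l \<in> {lam_min P .. 0} \<Longrightarrow> \<rho> P l \<in> {- y_max P .. y_max P}"
  using subsetD[OF path_in_X imageI, of l] by (auto simp: X_def ref_path_def)

lemma path_state_in_Z:
  assumes "l \<in> {lam_min P .. 0}"
  shows "(ref_path P l, l) \<in> Z P"
  using assms \<rho>_bounds[OF assms] by (auto simp: Z_def X_def ref_path_def lam_min_def)

lemma d\<rho>_cont: "continuous_on {lam_min P .. 0} (d\<rho> P)"
  using d\<rho>_diff by (rule differentiable_imp_continuous_on)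

lemma \<rho>_deriv:
  "l \<in> {lam_min P .. 0} \<Longrightarrow> (\<rho> P has_vector_derivative d\<rho> P l) (at l within {lam_min P .. 0})"
  using \<rho>_diff unfolding d\<rho>_def differentiable_on_def by (simp add: vector_derivative_works)

lemma d\<rho>_deriv:
  "l \<in> {lam_min P .. 0} \<Longrightarrow> (d\<rho> P has_vector_derivative dd\<rho> P l) (at l within {lam_min P .. 0})"
  using d\<rho>_diff unfolding dd\<rho>_def differentiable_on_def by (simp add: vector_derivative_works)

subsection \<open>The maximal path speed\<close>

definition feasible_speeds :: "real set" where
  "feasible_speeds = {g. g \<in> {0 .. g_max P} \<and> (\<forall>l \<in> {lam_min P .. 0}. u_ref P l g \<in> U P)}"

text \<open>The reference input is linear in \<open>g\<close>; for \<open>g \<ge> 0\<close> each component is one upper bound, which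
  shows that the feasible speeds form a closed and downward closed set.\<close>

lemma feasible_speeds_iff:
  "g \<in> feasible_speeds \<longleftrightarrow> 0 \<le> g \<and> g \<le> g_max P \<and>
    (\<forall>l \<in> {lam_min P .. 0}. g * sqrt (1 + (d\<rho> P l)\<^sup>2) \<le> v_max P \<and>
       g * \<bar>dd\<rho> P l / (1 + (d\<rho> P l)\<^sup>2)\<bar> \<le> \<omega>_max P)"
proof -
  have "u_ref P l g \<in> U P \<longleftrightarrow> g * sqrt (1 + (d\<rho> P l)\<^sup>2) \<le> v_max P \<and>
       g * \<bar>dd\<rho> P l / (1 + (d\<rho> P l)\<^sup>2)\<bar> \<le> \<omega>_max P" if "0 \<le> g" for l
  proof -
    have "0 \<le> g * sqrt (1 + (d\<rho> P l)\<^sup>2)" using that by simp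
    then have "- v_max P \<le> g * sqrt (1 + (d\<rho> P l)\<^sup>2)" using pos by linarith
    moreover have "g * \<bar>dd\<rho> P l / (1 + (d\<rho> P l)\<^sup>2)\<bar> = \<bar>g * dd\<rho> P l / (1 + (d\<rho> P l)\<^sup>2)\<bar>"
      using that by (simp add: abs_mult)
    ultimately show ?thesis
      unfolding U_def u_ref_def mem_Times_iff fst_conv snd_conv atLeastAtMost_iff by argo
  qed
  then show ?thesis by (auto simp: feasible_speeds_def)
qed

lemma feasible_speeds_compact: "compact feasible_speeds"
proof -
  have "feasible_speeds = {0 .. g_max P} \<inter>
    (\<Inter>l \<in> {lam_min P .. 0}. {g. g * sqrt (1 + (d\<rho> P l)\<^sup>2) \<le> v_max P} \<inter>
       {g. g * \<bar>dd\<rho> P l / (1 + (d\<rho> P l)\<^sup>2)\<bar> \<le> \<omega>_max P})"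
    using lam_min_less by (auto simp: feasible_speeds_iff)
  moreover have "closed (\<Inter>l \<in> {lam_min P .. 0}. {g. g * sqrt (1 + (d\<rho> P l)\<^sup>2) \<le> v_max P} \<inter>
       {g. g * \<bar>dd\<rho> P l / (1 + (d\<rho> P l)\<^sup>2)\<bar> \<le> \<omega>_max P})"
    by (intro closed_INT ballI closed_Int closed_Collect_le continuous_intros)
  ultimately show ?thesis by (simp add: compact_Int_closed)
qed

text \<open>The path has bounded slope and curvature, as their continuity on a compact interval implies.\<close>

lemma positive_feasible_speed: "\<exists>g \<in> feasible_speeds. 0 < g"
proof -
  have nz: "1 + (d\<rho> P l)\<^sup>2 \<noteq> 0" for l by (smt (verit) zero_le_power2)
  have "continuous_on {lam_min P .. 0} (\<lambda>l. sqrt (1 + (d\<rho> P l)\<^sup>2))"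
    by (intro continuous_intros d\<rho>_cont)
  then have "bounded ((\<lambda>l. sqrt (1 + (d\<rho> P l)\<^sup>2)) ` {lam_min P .. 0})"
    by (intro compact_imp_bounded compact_continuous_image) auto
  then obtain M where M_pos: "0 < M"
    and "\<forall>v \<in> (\<lambda>l. sqrt (1 + (d\<rho> P l)\<^sup>2)) ` {lam_min P .. 0}. norm v \<le> M"
    unfolding bounded_pos by blast
  then have M: "sqrt (1 + (d\<rho> P l)\<^sup>2) \<le> M" if "l \<in> {lam_min P .. 0}" for l
    using that by auto
  have "continuous_on {lam_min P .. 0} (\<lambda>l. dd\<rho> P l / (1 + (d\<rho> P l)\<^sup>2))"
    using nz by (intro continuous_intros d\<rho>_cont dd\<rho>_cont) auto
  then have "bounded ((\<lambda>l. dd\<rho> P l / (1 + (d\<rho> P l)\<^sup>2)) ` {lam_min P .. 0})"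
    by (intro compact_imp_bounded compact_continuous_image) auto
  then obtain N where N_pos: "0 < N"
    and "\<forall>v \<in> (\<lambda>l. dd\<rho> P l / (1 + (d\<rho> P l)\<^sup>2)) ` {lam_min P .. 0}. norm v \<le> N"
    unfolding bounded_pos by blast
  then have N: "\<bar>dd\<rho> P l / (1 + (d\<rho> P l)\<^sup>2)\<bar> \<le> N" if "l \<in> {lam_min P .. 0}" for l
    using that by (simp only: image_iff real_norm_def) blast
  define g where "g = min (g_max P) (min (v_max P / M) (\<omega>_max P / N))"
  have "0 < g" "g \<le> g_max P" "g \<le> v_max P / M" "g \<le> \<omega>_max P / N"
    using pos M_pos N_pos by (auto simp: g_def)
  then have g: "0 < g" "g \<le> g_max P" "g * M \<le> v_max P" "g * N \<le> \<omega>_max P"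
    using M_pos N_pos by (simp_all add: pos_le_divide_eq)
  have "g * sqrt (1 + (d\<rho> P l)\<^sup>2) \<le> v_max P \<and> g * \<bar>dd\<rho> P l / (1 + (d\<rho> P l)\<^sup>2)\<bar> \<le> \<omega>_max P"
    if "l \<in> {lam_min P .. 0}" for l
    using mult_left_mono[OF M[OF that], of g] mult_left_mono[OF N[OF that], of g] g by linarith
  then show ?thesis using g by (auto simp: feasible_speeds_iff)
qed

lemma g_hat_feasible: "g_hat P \<in> feasible_speeds" and g_hat_pos: "0 < g_hat P"
proof -
  obtain g where g: "g \<in> feasible_speeds" "\<And>h. h \<in> feasible_speeds \<Longrightarrow> h \<le> g"
    using compact_attains_sup[OF feasible_speeds_compact] positive_feasible_speed by auto
  have "g_hat P = g"
    unfolding g_hat_def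
    by (rule Greatest_equality) (use g in \<open>auto simp: feasible_speeds_def\<close>)
  then show "g_hat P \<in> feasible_speeds" "0 < g_hat P"
    using g positive_feasible_speed by force+
qed

lemma feasible_speeds_downward: "g \<in> feasible_speeds \<Longrightarrow> 0 \<le> h \<Longrightarrow> h \<le> g \<Longrightarrow> h \<in> feasible_speeds"
  unfolding feasible_speeds_iff
  by (auto simp del: times_divide_eq_right abs_divide intro: order.trans[OF mult_right_mono])

lemma times_pos: "0 < t\<^sub>r P" "0 < t\<^sub>l P" "0 < t\<^sub>g P"
  using pos g_hat_pos lam_min_less by (simp_all add: t\<^sub>r_def t\<^sub>l_def t\<^sub>g_def add_pos_nonneg divide_neg_pos)

subsection \<open>Arcs with fixed path parameter\<close>

lemma stage_cost_at_standstill: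
  "stage_cost P ((x, y, \<theta>), l) ((v, \<omega>), 0) =
     q\<^sub>1 P * (x - l)\<^sup>2 + q\<^sub>2 P * (y - \<rho> P l)\<^sup>2 + q\<^sub>3 P * (\<theta> - arctan (d\<rho> P l))\<^sup>2 + q_hat P * l\<^sup>2
     + r\<^sub>1 P * v\<^sup>2 + r\<^sub>2 P * \<omega>\<^sup>2"
  by (simp add: u_ref_def)

lemma zero_in_W: "((0, 0), 0) \<in> W P"
  using pos by (simp add: W_def U_def)

text \<open>All input terms of the stage cost are nonnegative, and \<open>u_ref P l 0 = 0\<close> makes them vanish
  together at the zero input.\<close>

lemma min_stage_cost_eq:
  "min_stage_cost P ((x, y, \<theta>), l) =
     q\<^sub>1 P * (x - l)\<^sup>2 + q\<^sub>2 P * (y - \<rho> P l)\<^sup>2 + q\<^sub>3 P * (\<theta> - arctan (d\<rho> P l))\<^sup>2 + q_hat P * l\<^sup>2"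
  (is "_ = ?c")
  unfolding min_stage_cost_def
proof (rule Least_equality)
  show "?c \<in> stage_cost P ((x, y, \<theta>), l) ` W P"
    using zero_in_W by (intro image_eqI[of _ _ "((0, 0), 0)"]) (simp_all add: stage_cost_at_standstill del: stage_cost.simps)
  show "?c \<le> c" if "c \<in> stage_cost P ((x, y, \<theta>), l) ` W P" for c
    using that cost_pos by (auto intro!: add_nonneg_nonneg mult_nonneg_nonneg simp: add.assoc)
qed

lemma min_stage_cost_ge: "q_hat P * (snd z)\<^sup>2 \<le> min_stage_cost P z"
  using cost_pos by (cases z) (auto simp: min_stage_cost_eq)

lemma min_stage_cost_nonneg: "0 \<le> min_stage_cost P z"
  by (rule order.trans[OF _ min_stage_cost_ge]) (use cost_pos in simp)

lemma min_stage_cost_on_path: "min_stage_cost P (ref_path P l, l) = q_hat P * l\<^sup>2"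
  by (simp add: ref_path_def min_stage_cost_eq)

lemma steers_rest:
  assumes "z \<in> Z P" "0 \<le> T"
  shows "steers P z T z (T * min_stage_cost P z)"
proof (rule steers_arc_le[where w = "\<lambda>_. ((0, 0), 0)" and z = "\<lambda>_. z"])
  obtain x y \<theta> l where z: "z = ((x, y, \<theta>), l)" by (metis prod.exhaust)
  then have "f\<^sub>g z ((0, 0), 0) = 0" by (simp add: zero_prod_def)
  then show "((\<lambda>_. z) has_vector_derivative f\<^sub>g z ((0, 0), 0)) (at \<tau> within {0..T})" for \<tau> by simp
  show "stage_cost P z ((0, 0), 0) \<le> min_stage_cost P z"
    by (simp only: z stage_cost_at_standstill min_stage_cost_eq) simp
qed (use assms zero_in_W in auto)

lemma steers_turn:
  assumes "x \<in> {- x_max P .. - \<epsilon> P}" "y \<in> {- y_max P .. y_max P}" "l \<in> {lam_min P .. - \<epsilon> P}"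
    and "0 \<le> T" and turn: "\<bar>\<theta>' - \<theta>\<bar> \<le> \<omega>_max P * T"
    and m: "\<bar>\<theta> - arctan (d\<rho> P l)\<bar> \<le> m" "\<bar>\<theta>' - arctan (d\<rho> P l)\<bar> \<le> m"
  shows "steers P ((x, y, \<theta>), l) T ((x, y, \<theta>'), l)
    (T * (q\<^sub>1 P * (x - l)\<^sup>2 + q\<^sub>2 P * (y - \<rho> P l)\<^sup>2 + q\<^sub>3 P * m\<^sup>2 + q_hat P * l\<^sup>2
      + r\<^sub>2 P * (\<omega>_max P)\<^sup>2))"
proof -
  \<comment> \<open>For \<open>T = 0\<close> this is \<open>0\<close>, which is the right rate since then \<open>\<theta>' = \<theta>\<close>.\<close>
  define r where "r = (\<theta>' - \<theta>) / T"
  have rate: "\<bar>r\<bar> \<le> \<omega>_max P"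
    using turn assms(4) pos by (cases "T = 0") (auto simp: r_def abs_divide field_simps)
  have end_heading: "\<theta> + r * T = \<theta>'"
    using turn by (cases "T = 0") (auto simp: r_def)
  show ?thesis
  proof (rule steers_arc_le[where w = "\<lambda>_. ((0, r), 0)" and z = "\<lambda>\<tau>. ((x, y, \<theta> + r * \<tau>), l)"])
    fix \<tau> assume \<tau>: "0 \<le> \<tau>" "\<tau> \<le> T"
    show "((0, r), 0) \<in> W P" using rate pos by (auto simp: W_def U_def)
    show "((x, y, \<theta> + r * \<tau>), l) \<in> Z P" using assms by (auto simp: Z_def X_def)
    show "((\<lambda>\<tau>. ((x, y, \<theta> + r * \<tau>), l)) has_vector_derivative
        f\<^sub>g ((x, y, \<theta> + r * \<tau>), l) ((0, r), 0)) (at \<tau> within {0..T})"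
      by (auto intro!: derivative_eq_intros has_vector_derivative_Pair)
    have "\<theta> + r * \<tau> - arctan (d\<rho> P l) =
        (1 - \<tau> / T) * (\<theta> - arctan (d\<rho> P l)) + \<tau> / T * (\<theta>' - arctan (d\<rho> P l))"
      using \<tau> end_heading by (cases "T = 0") (auto simp: r_def field_simps)
    moreover have "0 \<le> \<tau> / T" "\<tau> / T \<le> 1" using \<tau> by (auto simp: divide_simps)
    ultimately have "\<bar>\<theta> + r * \<tau> - arctan (d\<rho> P l)\<bar> \<le> m"
      using abs_convex_combination_le[OF m] by (simp only:)
    then have "q\<^sub>3 P * (\<theta> + r * \<tau> - arctan (d\<rho> P l))\<^sup>2 \<le> q\<^sub>3 P * m\<^sup>2"
      using cost_pos by (intro mult_left_mono abs_le_square_iff[THEN iffD1]) auto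
    moreover have "r\<^sub>2 P * r\<^sup>2 \<le> r\<^sub>2 P * (\<omega>_max P)\<^sup>2"
      using rate cost_pos by (intro mult_left_mono abs_le_square_iff[THEN iffD1]) auto
    ultimately show "stage_cost P ((x, y, \<theta> + r * \<tau>), l) ((0, r), 0) \<le>
        q\<^sub>1 P * (x - l)\<^sup>2 + q\<^sub>2 P * (y - \<rho> P l)\<^sup>2 + q\<^sub>3 P * m\<^sup>2 + q_hat P * l\<^sup>2
        + r\<^sub>2 P * (\<omega>_max P)\<^sup>2"
      unfolding stage_cost_at_standstill by simp
  next
    show "continuous_on {0..T} (\<lambda>\<tau>. stage_cost P ((x, y, \<theta> + r * \<tau>), l) ((0, r), 0))"
      unfolding stage_cost_at_standstill by (intro continuous_intros)
  qed (use assms end_heading in auto)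
qed

text \<open>Driving to \<open>p(l)\<close> scales the position error linearly down to \<open>0\<close>, and the position stays in the
  rectangle of the constraints because the rectangle is convex.\<close>

lemma steers_drive:
  assumes "x \<in> {- x_max P .. - \<epsilon> P}" "y \<in> {- y_max P .. y_max P}" "l \<in> {lam_min P .. - \<epsilon> P}"
    and "0 < T" and d: "\<bar>d\<bar> \<le> v_max P * T" "l - x = d * cos \<theta>" "\<rho> P l - y = d * sin \<theta>"
    and m: "\<bar>\<theta> - arctan (d\<rho> P l)\<bar> \<le> m"
  shows "steers P ((x, y, \<theta>), l) T ((l, \<rho> P l, \<theta>), l)
    (T * (q\<^sub>1 P * (x - l)\<^sup>2 + q\<^sub>2 P * (y - \<rho> P l)\<^sup>2 + q\<^sub>3 P * m\<^sup>2 + q_hat P * l\<^sup>2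
      + r\<^sub>1 P * (v_max P)\<^sup>2))"
proof -
  define v where "v = d / T"
  have speed: "\<bar>v\<bar> \<le> v_max P"
    using d(1) assms(4) by (auto simp: v_def abs_divide field_simps)
  have on_segment: "x + v * \<tau> * cos \<theta> = (1 - \<tau> / T) * x + \<tau> / T * l"
    "y + v * \<tau> * sin \<theta> = (1 - \<tau> / T) * y + \<tau> / T * \<rho> P l" for \<tau>
  proof -
    have "v * \<tau> * cos \<theta> = \<tau> / T * (l - x)" "v * \<tau> * sin \<theta> = \<tau> / T * (\<rho> P l - y)"
      unfolding d(2,3) by (simp_all add: v_def)
    then show "x + v * \<tau> * cos \<theta> = (1 - \<tau> / T) * x + \<tau> / T * l"
      "y + v * \<tau> * sin \<theta> = (1 - \<tau> / T) * y + \<tau> / T * \<rho> P l"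
      by (simp_all add: algebra_simps diff_divide_distrib)
  qed
  let ?z = "\<lambda>\<tau>. ((x + v * \<tau> * cos \<theta>, y + v * \<tau> * sin \<theta>, \<theta>), l)"
  show ?thesis
  proof (rule steers_arc_le[where w = "\<lambda>_. ((v, 0), 0)" and z = ?z])
    show "?z T = ((l, \<rho> P l, \<theta>), l)" using assms(4) by (simp only: on_segment) simp
    fix \<tau> assume \<tau>: "0 \<le> \<tau>" "\<tau> \<le> T"
    have u: "0 \<le> \<tau> / T" "\<tau> / T \<le> 1" using \<tau> assms(4) by (auto simp: divide_simps)
    show "((v, 0), 0) \<in> W P" using speed pos by (auto simp: W_def U_def)
    have "x + v * \<tau> * cos \<theta> \<in> {- x_max P .. - \<epsilon> P}"
      unfolding on_segment
      using convexD[OF convex_real_interval(5), of x "- x_max P" "- \<epsilon> P" l "1 - \<tau> / T" "\<tau> / T"] assms(1,3) u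
      by (auto simp: lam_min_def)
    moreover have "y + v * \<tau> * sin \<theta> \<in> {- y_max P .. y_max P}"
      unfolding on_segment
      using convexD[OF convex_real_interval(5), of y "- y_max P" "y_max P" "\<rho> P l" "1 - \<tau> / T" "\<tau> / T"]
        assms(2,3) \<rho>_bounds[of l] u eps by auto
    ultimately show "?z \<tau> \<in> Z P" using assms(3) by (auto simp: Z_def X_def)
    show "(?z has_vector_derivative f\<^sub>g (?z \<tau>) ((v, 0), 0)) (at \<tau> within {0..T})"
      by (auto intro!: derivative_eq_intros has_vector_derivative_Pair)
    have "x + v * \<tau> * cos \<theta> - l = (1 - \<tau> / T) * (x - l)"
      "y + v * \<tau> * sin \<theta> - \<rho> P l = (1 - \<tau> / T) * (y - \<rho> P l)"
      unfolding on_segment by (simp_all add: algebra_simps diff_divide_distrib)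
    moreover have "(1 - \<tau> / T)\<^sup>2 \<le> 1" using u by (simp add: power_le_one)
    ultimately have "(x + v * \<tau> * cos \<theta> - l)\<^sup>2 \<le> (x - l)\<^sup>2"
      "(y + v * \<tau> * sin \<theta> - \<rho> P l)\<^sup>2 \<le> (y - \<rho> P l)\<^sup>2"
      by (simp_all add: power_mult_distrib mult_left_le_one_le)
    then have "q\<^sub>1 P * (x + v * \<tau> * cos \<theta> - l)\<^sup>2 \<le> q\<^sub>1 P * (x - l)\<^sup>2"
      "q\<^sub>2 P * (y + v * \<tau> * sin \<theta> - \<rho> P l)\<^sup>2 \<le> q\<^sub>2 P * (y - \<rho> P l)\<^sup>2"
      using cost_pos by simp_all
    moreover have "q\<^sub>3 P * (\<theta> - arctan (d\<rho> P l))\<^sup>2 \<le> q\<^sub>3 P * m\<^sup>2"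
      using m cost_pos by (intro mult_left_mono abs_le_square_iff[THEN iffD1]) auto
    moreover have "r\<^sub>1 P * v\<^sup>2 \<le> r\<^sub>1 P * (v_max P)\<^sup>2"
      using speed cost_pos by (intro mult_left_mono abs_le_square_iff[THEN iffD1]) auto
    ultimately show "stage_cost P (?z \<tau>) ((v, 0), 0) \<le>
        q\<^sub>1 P * (x - l)\<^sup>2 + q\<^sub>2 P * (y - \<rho> P l)\<^sup>2 + q\<^sub>3 P * m\<^sup>2 + q_hat P * l\<^sup>2
        + r\<^sub>1 P * (v_max P)\<^sup>2"
      unfolding stage_cost_at_standstill by simp
  next
    show "continuous_on {0..T} (\<lambda>\<tau>. stage_cost P (?z \<tau>) ((v, 0), 0))"
      unfolding stage_cost_at_standstill by (intro continuous_intros)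
  qed (use assms in auto)
qed


subsection \<open>Following the path\<close>

text \<open>The stage cost along the path, relative to the initial value of \<open>q_hat P * l\<^sup>2\<close>.\<close>

definition path_cost_rate :: "real \<Rightarrow> real" where
  "path_cost_rate s = ((t\<^sub>g P - s)\<^sup>2 + r_hat P / q_hat P) / (t\<^sub>g P)\<^sup>2"

lemma path_cost_rate_cont: "continuous_on S path_cost_rate"
  unfolding path_cost_rate_def using times_pos by (intro continuous_intros) auto

text \<open>The reference input makes the path itself a solution: since \<open>cos (arctan a) = 1 / sqrt (1 + a\<^sup>2)\<close>,
  the speed \<open>g sqrt (1 + a\<^sup>2)\<close> yields the velocity \<open>(g, g a)\<close>, and the reference turning rate is the chain
  rule for \<open>arctan (d\<rho> P l)\<close>. The rate \<open>- l / t\<^sub>g\<close> brings \<open>l\<close> to \<open>0\<close> in time \<open>t\<^sub>g\<close>; it does not exceed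
  \<open>g_hat P\<close>, as \<open>t\<^sub>g\<close> is the time that \<open>g_hat P\<close> needs for the whole path.\<close>

lemma steers_along_path:
  assumes l: "l \<in> {lam_min P .. 0}" and T: "0 \<le> T" "T \<le> t\<^sub>g P"
  shows "steers P (ref_path P l, l) T (ref_path P (l - l / t\<^sub>g P * T), l - l / t\<^sub>g P * T)
    (q_hat P * l\<^sup>2 * integral {0..T} path_cost_rate)"
proof -
  define g where "g = - l / t\<^sub>g P"
  let ?k = "\<lambda>\<tau>. l + g * \<tau>"
  have g: "0 \<le> g" "g \<le> g_hat P"
  proof -
    show "0 \<le> g" using l times_pos by (simp add: g_def divide_nonpos_pos)
    have "- l * g_hat P \<le> - lam_min P * g_hat P"
      using l g_hat_pos by (intro mult_right_mono) auto
    then show "g \<le> g_hat P"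
      using lam_min_less g_hat_pos by (simp add: g_def t\<^sub>g_def field_simps)
  qed
  have feasible: "g \<in> feasible_speeds" using g g_hat_feasible feasible_speeds_downward by blast
  have k: "?k \<tau> \<in> {lam_min P .. 0}" "?k \<tau> = l * (t\<^sub>g P - \<tau>) / t\<^sub>g P" if "0 \<le> \<tau>" "\<tau> \<le> T" for \<tau>
  proof -
    show eq: "?k \<tau> = l * (t\<^sub>g P - \<tau>) / t\<^sub>g P" using times_pos by (simp add: g_def field_simps)
    have "l * (t\<^sub>g P - \<tau>) / t\<^sub>g P \<le> 0"
      using l times_pos that T by (intro divide_nonpos_pos mult_nonpos_nonneg) auto
    moreover have "l \<le> ?k \<tau>" using g(1) that by simp
    ultimately show "?k \<tau> \<in> {lam_min P .. 0}" using l unfolding eq[symmetric] by auto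
  qed
  let ?z = "\<lambda>\<tau>. (ref_path P (?k \<tau>), ?k \<tau>)" and ?w = "\<lambda>\<tau>. (u_ref P (?k \<tau>) g, g)"
  show ?thesis
  proof (rule steers_arc[where w = ?w and z = ?z])
    show "continuous_on {0..T} ?w"
    proof -
      have nz: "1 + (d\<rho> P l)\<^sup>2 \<noteq> 0" for l by (smt (verit) zero_le_power2)
      have "continuous_on {0..T} (\<lambda>\<tau>. d\<rho> P (?k \<tau>))" "continuous_on {0..T} (\<lambda>\<tau>. dd\<rho> P (?k \<tau>))"
        using k by (auto intro!: continuous_on_compose2[OF d\<rho>_cont] continuous_on_compose2[OF dd\<rho>_cont]
            continuous_intros)
      then show ?thesis unfolding u_ref_def using nz by (intro continuous_intros) auto
    qed
    show "?z T = (ref_path P (l - l / t\<^sub>g P * T), l - l / t\<^sub>g P * T)" by (simp add: g_def)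
    fix \<tau> assume \<tau>: "0 \<le> \<tau>" "\<tau> \<le> T"
    show "?w \<tau> \<in> W P" using feasible k[OF \<tau>] by (auto simp: W_def feasible_speeds_def)
    show "?z \<tau> \<in> Z P" using k[OF \<tau>] path_state_in_Z by blast
    let ?a = "d\<rho> P (?k \<tau>)" and ?b = "dd\<rho> P (?k \<tau>)"
    have k': "(?k has_vector_derivative g) (at \<tau> within {0..T})"
      by (auto intro!: derivative_eq_intros)
    have sub: "?k ` {0..T} \<subseteq> {lam_min P .. 0}" using k by auto
    have "(\<rho> P \<circ> ?k has_vector_derivative g *\<^sub>R ?a) (at \<tau> within {0..T})"
      using \<rho>_deriv k[OF \<tau>] has_vector_derivative_within_subset[OF _ sub]
      by (intro vector_diff_chain_within[OF k']) blast
    then have y': "((\<lambda>\<tau>. \<rho> P (?k \<tau>)) has_vector_derivative g * ?a) (at \<tau> within {0..T})"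
      by (simp add: o_def)
    have "(d\<rho> P \<circ> ?k has_vector_derivative g *\<^sub>R ?b) (at \<tau> within {0..T})"
      using d\<rho>_deriv k[OF \<tau>] has_vector_derivative_within_subset[OF _ sub]
      by (intro vector_diff_chain_within[OF k']) blast
    then have "((\<lambda>\<tau>. d\<rho> P (?k \<tau>)) has_real_derivative g * ?b) (at \<tau> within {0..T})"
      by (simp add: o_def has_real_derivative_iff_has_vector_derivative)
    then have "((\<lambda>\<tau>. arctan (d\<rho> P (?k \<tau>))) has_real_derivative g * ?b / (1 + ?a\<^sup>2)) (at \<tau> within {0..T})"
      by (auto intro!: derivative_eq_intros simp: field_simps)
    then have \<theta>': "((\<lambda>\<tau>. arctan (d\<rho> P (?k \<tau>))) has_vector_derivative g * ?b / (1 + ?a\<^sup>2))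
        (at \<tau> within {0..T})"
      by (simp add: has_real_derivative_iff_has_vector_derivative)
    have "0 < sqrt (1 + ?a\<^sup>2)" by (simp add: add_pos_nonneg)
    then have "f\<^sub>g (?z \<tau>) (?w \<tau>) = ((g, g * ?a, g * ?b / (1 + ?a\<^sup>2)), g)"
      by (simp add: ref_path_def u_ref_def cos_arctan sin_arctan)
    then show "(?z has_vector_derivative f\<^sub>g (?z \<tau>) (?w \<tau>)) (at \<tau> within {0..T})"
      unfolding ref_path_def using k' y' \<theta>' by (simp add: has_vector_derivative_Pair)
  next
    have "((\<lambda>\<tau>. q_hat P * l\<^sup>2 * path_cost_rate \<tau>) has_integral
        q_hat P * l\<^sup>2 * integral {0..T} path_cost_rate) {0..T}"
      using path_cost_rate_cont by (intro has_integral_mult_right integrable_integral integrable_continuous_interval)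
    moreover have "q_hat P * l\<^sup>2 * path_cost_rate \<tau> = stage_cost P (?z \<tau>) (?w \<tau>)" if "\<tau> \<in> {0..T}" for \<tau>
    proof -
      have "stage_cost P (?z \<tau>) (?w \<tau>) = q_hat P * (?k \<tau>)\<^sup>2 + r_hat P * g\<^sup>2"
        by (cases "u_ref P (?k \<tau>) g") (simp add: ref_path_def)
      also have "(?k \<tau>)\<^sup>2 = l\<^sup>2 * (t\<^sub>g P - \<tau>)\<^sup>2 / (t\<^sub>g P)\<^sup>2"
        using k(2)[of \<tau>] that by (simp add: power_divide power_mult_distrib)
      also have "q_hat P * \<dots> + r_hat P * g\<^sup>2 = q_hat P * l\<^sup>2 * path_cost_rate \<tau>"
        using cost_pos by (simp add: g_def path_cost_rate_def power_divide algebra_simps add_divide_distrib)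
      finally show ?thesis ..
    qed
    ultimately show "((\<lambda>\<tau>. stage_cost P (?z \<tau>) (?w \<tau>)) has_integral
        q_hat P * l\<^sup>2 * integral {0..T} path_cost_rate) {0..T}"
      by (rule has_integral_eq[rotated])
  qed (use T in auto)
qed

subsection \<open>The integral of the cost profile\<close>

definition t_join :: real where
  "t_join = 4 * t\<^sub>r P + t\<^sub>l P"

lemma t_join_pos: "0 < t_join"
  using times_pos by (simp add: t_join_def)

lemma c_fun_turn_out:
  assumes "0 \<le> t" "t < t\<^sub>r P"
  shows "c_fun P t = 1 + q\<^sub>3 P * pi\<^sup>2 * (t\<^sup>2 + 6 * t\<^sub>r P * t + 1/2) / (4 * (t\<^sub>r P)\<^sup>2 * q_hat P * (\<epsilon> P)\<^sup>2)"
  using assms by (simp add: c_fun_def)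

lemma c_fun_drive:
  assumes "t\<^sub>r P \<le> t" "t < t\<^sub>r P + t\<^sub>l P"
  shows "c_fun P t = 1 + (q\<^sub>3 P * (3 * pi / 2)\<^sup>2 + r\<^sub>1 P * (v_max P)\<^sup>2) / (q_hat P * (\<epsilon> P)\<^sup>2)"
  using assms by (simp add: c_fun_def)

lemma c_fun_turn_in:
  assumes "t\<^sub>r P + t\<^sub>l P \<le> t" "t < t_join"
  shows "c_fun P t = 1 + q\<^sub>3 P * pi\<^sup>2 * ((t_join - t)\<^sup>2 + 1/2) / (4 * (t\<^sub>r P)\<^sup>2 * q_hat P * (\<epsilon> P)\<^sup>2)"
  using assms times_pos by (simp add: c_fun_def t_join_def)

lemma c_fun_path:
  assumes "t_join \<le> t" "t < t_join + t\<^sub>g P"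
  shows "c_fun P t = path_cost_rate (t - t_join)"
  using assms times_pos by (simp add: c_fun_def t_join_def path_cost_rate_def algebra_simps)

lemma c_fun_late:
  assumes "t_join + t\<^sub>g P \<le> t"
  shows "c_fun P t = 0"
  using assms times_pos by (simp add: c_fun_def t_join_def)

lemma c_fun_nonneg: "0 \<le> t \<Longrightarrow> 0 \<le> c_fun P t"
  and c_fun_ge_1: "0 \<le> t \<Longrightarrow> t < t_join \<Longrightarrow> 1 \<le> c_fun P t"
proof -
  show ge: "1 \<le> c_fun P t" if "0 \<le> t" "t < t_join" for t
  proof -
    consider "t < t\<^sub>r P" | "t\<^sub>r P \<le> t" "t < t\<^sub>r P + t\<^sub>l P" | "t\<^sub>r P + t\<^sub>l P \<le> t" by linarith
    then show ?thesis
      by cases (use that times_pos cost_pos eps in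
          \<open>simp_all add: c_fun_turn_out c_fun_drive c_fun_turn_in\<close>)
  qed
  show "0 \<le> c_fun P t" if "0 \<le> t"
  proof -
    consider "t < t_join" | "t_join \<le> t" "t < t_join + t\<^sub>g P" | "t_join + t\<^sub>g P \<le> t" by linarith
    then show ?thesis
      by cases (use that ge[of t] cost_pos in
          \<open>simp_all add: c_fun_path c_fun_late path_cost_rate_def\<close>)
  qed
qed

lemma c_fun_integrable: "c_fun P integrable_on {0..t}"
proof -
  note [simp] = times_pos[THEN less_imp_le]
  define M where "M = max t (t_join + t\<^sub>g P)"
  have piece: "c_fun P integrable_on {a..b}"
    if "continuous_on {a..b} f" "\<And>t. a \<le> t \<Longrightarrow> t < b \<Longrightarrow> c_fun P t = f t" for a b f
    using has_integral_continuous_Ico[OF that] by blast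
  have "c_fun P integrable_on {0..t\<^sub>r P}"
    by (rule piece[OF _ c_fun_turn_out])
       (use times_pos cost_pos eps in \<open>auto intro!: continuous_intros\<close>)
  moreover have "c_fun P integrable_on {t\<^sub>r P .. t\<^sub>r P + t\<^sub>l P}"
    by (rule piece[OF _ c_fun_drive]) (auto intro!: continuous_intros)
  ultimately have "c_fun P integrable_on {0..t\<^sub>r P + t\<^sub>l P}"
    by (rule Henstock_Kurzweil_Integration.integrable_combine[rotated 2]) auto
  moreover have "c_fun P integrable_on {t\<^sub>r P + t\<^sub>l P .. t_join}"
    by (rule piece[OF _ c_fun_turn_in])
       (use times_pos cost_pos eps in \<open>auto intro!: continuous_intros\<close>)
  ultimately have "c_fun P integrable_on {0..t_join}"
    by (rule Henstock_Kurzweil_Integration.integrable_combine[rotated 2]) (auto simp: t_join_def)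
  moreover have "c_fun P integrable_on {t_join .. t_join + t\<^sub>g P}"
    by (rule piece[OF _ c_fun_path])
       (use path_cost_rate_cont in \<open>auto intro!: continuous_intros intro: continuous_on_compose2\<close>)
  ultimately have "c_fun P integrable_on {0..t_join + t\<^sub>g P}"
    by (rule Henstock_Kurzweil_Integration.integrable_combine[rotated 2])
       (use t_join_pos in auto)
  moreover have "c_fun P integrable_on {t_join + t\<^sub>g P .. M}"
    by (rule piece[OF _ c_fun_late]) auto
  ultimately have "c_fun P integrable_on {0..M}"
    by (rule Henstock_Kurzweil_Integration.integrable_combine[rotated 2])
       (use t_join_pos in \<open>auto simp: M_def\<close>)
  then show ?thesis by (rule integrable_on_subinterval) (auto simp: M_def)
qed

lemma c_fun_integrable_Icc: "0 \<le> a \<Longrightarrow> c_fun P integrable_on {a..b}"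
  using c_fun_integrable[of b] by (rule integrable_on_subinterval) auto

lemma c_integral_split:
  "0 \<le> a \<Longrightarrow> a \<le> b \<Longrightarrow> integral {0..b} (c_fun P) = integral {0..a} (c_fun P) + integral {a..b} (c_fun P)"
  using Henstock_Kurzweil_Integration.integral_combine[of 0 a b "c_fun P"] c_fun_integrable by simp

lemma c_integral_path:
  assumes "0 \<le> T" "T \<le> t\<^sub>g P"
  shows "integral {t_join .. t_join + T} (c_fun P) = integral {0..T} path_cost_rate"
proof -
  have "(path_cost_rate has_integral integral {0..T} path_cost_rate) {0..T}"
    using path_cost_rate_cont by (intro integrable_integral integrable_continuous_interval)
  then have "((\<lambda>t. path_cost_rate (t - t_join)) has_integral integral {0..T} path_cost_rate)
      {t_join .. t_join + T}"
    using has_integral_shift_real_ivl[of path_cost_rate _ 0 T "- t_join"] by (simp add: add.commute)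
  then have "(c_fun P has_integral integral {0..T} path_cost_rate) {t_join .. t_join + T}"
    by (rule has_integral_spike_finite[of "{t_join + T}", rotated 2])
       (use assms in \<open>auto intro!: c_fun_path\<close>)
  then show ?thesis by (rule integral_unique)
qed

text \<open>What the manoeuvre onto the path may cost in excess of resting, relative to the lower
  bound \<open>D\<close> of the optimal stage cost for \<open>\<lambda> \<le> - \<epsilon>\<close>. In the last turning phase the integral of the
  squared remaining time is \<open>9 t\<^sub>r\<^sup>3\<close>; this exceeds \<open>4 t\<^sub>r\<^sup>3\<close> and so pays for a squared error of \<open>\<pi>\<^sup>2/4\<close>
  during both turns. The summands \<open>1/2\<close> of the two turning phases pay for the steering effort, since
  \<open>r\<^sub>2 \<le> q\<^sub>3/2\<close> and \<open>\<omega>_max = \<pi> / (2 t\<^sub>r)\<close>.\<close>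

lemma c_integral_join_ge:
  fixes D :: real
  defines "D \<equiv> q_hat P * (\<epsilon> P)\<^sup>2"
  shows "t_join + (4 * t\<^sub>r P * (q\<^sub>3 P * pi\<^sup>2 / 4 + r\<^sub>2 P * (\<omega>_max P)\<^sup>2)
      + t\<^sub>l P * (q\<^sub>3 P * pi\<^sup>2 / 4 + r\<^sub>1 P * (v_max P)\<^sup>2)) / D
    \<le> integral {0..t_join} (c_fun P)"
proof -
  define K where "K = q\<^sub>3 P * pi\<^sup>2 / (4 * (t\<^sub>r P)\<^sup>2 * D)"
  have D: "0 < D" using cost_pos eps by (simp add: D_def)
  have K: "0 < K" using D cost_pos times_pos by (simp add: K_def)
  have K_eq: "q\<^sub>3 P * pi\<^sup>2 * s / (4 * (t\<^sub>r P)\<^sup>2 * q_hat P * (\<epsilon> P)\<^sup>2) = K * s" for s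
    by (simp add: K_def D_def mult.assoc)
  have const: "(b - a) * m \<le> integral {a..b} (c_fun P)"
    if "0 \<le> a" "a \<le> b" "\<And>t. a \<le> t \<Longrightarrow> t < b \<Longrightarrow> m \<le> c_fun P t" for a b m
  proof -
    have m: "((\<lambda>t. if t = b then c_fun P b else m) has_integral (b - a) * m) {a..b}"
      by (rule has_integral_spike_finite[of "{b}" _ _ "\<lambda>_. m"])
         (use has_integral_const_real[of m a b] that in auto)
    show ?thesis
      by (rule has_integral_le[OF m integrable_integral[OF c_fun_integrable_Icc]]) (use that in auto)
  qed
  have 1: "(t\<^sub>r P - 0) * (1 + K / 2) \<le> integral {0..t\<^sub>r P} (c_fun P)"
  proof (rule const)
    fix t assume t: "0 \<le> t" "t < t\<^sub>r P"
    have "K * (1/2) \<le> K * (t\<^sup>2 + 6 * t\<^sub>r P * t + 1/2)"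
      using t K times_pos by (intro mult_left_mono) auto
    then show "1 + K / 2 \<le> c_fun P t" using c_fun_turn_out[OF t] K_eq by simp
  qed (use times_pos in auto)
  have 2: "(t\<^sub>r P + t\<^sub>l P - t\<^sub>r P) * (1 + (q\<^sub>3 P * pi\<^sup>2 / 4 + r\<^sub>1 P * (v_max P)\<^sup>2) / D) \<le> integral {t\<^sub>r P .. t\<^sub>r P + t\<^sub>l P} (c_fun P)"
  proof (rule const)
    fix t assume t: "t\<^sub>r P \<le> t" "t < t\<^sub>r P + t\<^sub>l P"
    have "q\<^sub>3 P * pi\<^sup>2 / 4 \<le> q\<^sub>3 P * (3 * pi / 2)\<^sup>2"
      using cost_pos by (simp add: power_divide power_mult_distrib)
    then show "1 + (q\<^sub>3 P * pi\<^sup>2 / 4 + r\<^sub>1 P * (v_max P)\<^sup>2) / D \<le> c_fun P t"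
      unfolding c_fun_drive[OF t] D_def[symmetric] using D by (simp add: divide_right_mono)
  qed (use times_pos in auto)
  have 3: "integral {t\<^sub>r P + t\<^sub>l P .. t_join} (c_fun P) = 3 * t\<^sub>r P + K * (9 * (t\<^sub>r P)^3 + 3 / 2 * t\<^sub>r P)"
  proof -
    let ?F = "\<lambda>t. t + K * (t / 2 - (t_join - t)^3 / 3)"
    have "((\<lambda>t. 1 + K * ((t_join - t)\<^sup>2 + 1/2)) has_integral ?F t_join - ?F (t\<^sub>r P + t\<^sub>l P))
        {t\<^sub>r P + t\<^sub>l P .. t_join}"
      using times_pos
      by (intro fundamental_theorem_of_calculus)
         (auto intro!: derivative_eq_intros simp: t_join_def has_real_derivative_iff_has_vector_derivative[symmetric])
    then have "(c_fun P has_integral ?F t_join - ?F (t\<^sub>r P + t\<^sub>l P)) {t\<^sub>r P + t\<^sub>l P .. t_join}"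
      by (rule has_integral_spike_finite[of "{t_join}", rotated 2])
         (auto simp: c_fun_turn_in K_eq)
    moreover have "?F t_join - ?F (t\<^sub>r P + t\<^sub>l P) = 3 * t\<^sub>r P + K * (9 * (t\<^sub>r P)^3 + 3 / 2 * t\<^sub>r P)"
      by (simp add: t_join_def field_simps power3_eq_cube)
    ultimately show ?thesis by (simp add: integral_unique)
  qed
  have "integral {0..t_join} (c_fun P) = integral {0..t\<^sub>r P} (c_fun P)
      + integral {t\<^sub>r P .. t\<^sub>r P + t\<^sub>l P} (c_fun P) + integral {t\<^sub>r P + t\<^sub>l P .. t_join} (c_fun P)"
    using c_integral_split[of "t\<^sub>r P" "t\<^sub>r P + t\<^sub>l P"] c_integral_split[of "t\<^sub>r P + t\<^sub>l P" t_join] times_pos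
    by (simp add: t_join_def)
  then have lower: "t_join + t\<^sub>l P * ((q\<^sub>3 P * pi\<^sup>2 / 4 + r\<^sub>1 P * (v_max P)\<^sup>2) / D) + K * (9 * (t\<^sub>r P)^3 + 2 * t\<^sub>r P)
      \<le> integral {0..t_join} (c_fun P)"
    using 1 2 3 by (simp add: t_join_def algebra_simps)
  have "r\<^sub>2 P * (\<omega>_max P)\<^sup>2 \<le> q\<^sub>3 P / 2 * (\<omega>_max P)\<^sup>2"
    using r2_le by (intro mult_right_mono) auto
  moreover have "\<omega>_max P = pi / (2 * t\<^sub>r P)" using pos by (simp add: t\<^sub>r_def)
  ultimately have "r\<^sub>2 P * (\<omega>_max P)\<^sup>2 \<le> K * D / 2"
    using D times_pos by (simp add: K_def power_divide power_mult_distrib)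
  then have "4 * t\<^sub>r P * (r\<^sub>2 P * (\<omega>_max P)\<^sup>2) \<le> 4 * t\<^sub>r P * (K * D / 2)"
    using times_pos by (intro mult_left_mono) auto
  moreover have "q\<^sub>3 P * pi\<^sup>2 / 4 = K * D * (t\<^sub>r P)\<^sup>2" using D times_pos by (simp add: K_def)
  then have "4 * t\<^sub>r P * (q\<^sub>3 P * pi\<^sup>2 / 4) \<le> 9 * (t\<^sub>r P)^3 * (K * D)"
    using D K times_pos by (simp add: power3_eq_cube power2_eq_square)
  ultimately have "4 * t\<^sub>r P * (q\<^sub>3 P * pi\<^sup>2 / 4 + r\<^sub>2 P * (\<omega>_max P)\<^sup>2) \<le> K * (9 * (t\<^sub>r P)^3 + 2 * t\<^sub>r P) * D"
    by (simp add: algebra_simps)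
  then have "4 * t\<^sub>r P * (q\<^sub>3 P * pi\<^sup>2 / 4 + r\<^sub>2 P * (\<omega>_max P)\<^sup>2) / D \<le> K * (9 * (t\<^sub>r P)^3 + 2 * t\<^sub>r P)"
    using D by (simp add: pos_divide_le_eq)
  moreover have "(a + t * x) / D = a / D + t * (x / D)" for a t x
    by (simp add: add_divide_distrib)
  ultimately show ?thesis using lower by (simp only:)
qed


subsection \<open>The manoeuvre onto the path\<close>

text \<open>The first turn takes the time it needs at full rate, and the second one the rest of \<open>4 t\<^sub>r\<close>. The
  drive takes exactly \<open>t\<^sub>l\<close>, the time that \<open>v_max P\<close> needs for the diagonal of the rectangle of admissible
  positions.\<close>

lemma steers_to_path:
  assumes z: "((x, y, \<theta>), l) \<in> X P (\<epsilon> P) \<times> {lam_min P .. - \<epsilon> P}"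
    and err: "\<bar>\<theta> - arctan (d\<rho> P l)\<bar> \<le> 2 * pi"
  shows "steers P ((x, y, \<theta>), l) t_join (ref_path P l, l)
    (t_join * min_stage_cost P ((x, y, \<theta>), l)
      + 4 * t\<^sub>r P * (q\<^sub>3 P * pi\<^sup>2 / 4 + r\<^sub>2 P * (\<omega>_max P)\<^sup>2)
      + t\<^sub>l P * (q\<^sub>3 P * pi\<^sup>2 / 4 + r\<^sub>1 P * (v_max P)\<^sup>2))"
proof -
  define \<psi> where "\<psi> = arctan (d\<rho> P l)"
  define e where "e = \<theta> - \<psi>"
  define m where "m = sqrt (e\<^sup>2 + pi\<^sup>2 / 4)"
  let ?L = "min_stage_cost P ((x, y, \<theta>), l)"
  have x: "x \<in> {- x_max P .. - \<epsilon> P}" and y: "y \<in> {- y_max P .. y_max P}"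
    and l: "l \<in> {lam_min P .. - \<epsilon> P}"
    using z by (auto simp: X_def)
  have l': "l \<in> {- x_max P .. - \<epsilon> P}" using l by (simp add: lam_min_def)
  have \<rho>l: "\<rho> P l \<in> {- y_max P .. y_max P}" using l eps by (intro \<rho>_bounds) auto
  obtain \<beta> d where \<beta>: "l - x = d * cos (\<psi> + \<beta>)" "\<rho> P l - y = d * sin (\<psi> + \<beta>)"
    "d\<^sup>2 = (l - x)\<^sup>2 + (\<rho> P l - y)\<^sup>2" "\<bar>\<beta> - e\<bar> + \<bar>\<beta>\<bar> \<le> 2 * pi" "\<beta>\<^sup>2 \<le> e\<^sup>2 + pi\<^sup>2 / 4"
    by (rule stopover_heading[of e "l - x" \<psi> "\<rho> P l - y"])
       (use err in \<open>auto simp: e_def \<psi>_def\<close>)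
  have m_sq: "m\<^sup>2 = e\<^sup>2 + pi\<^sup>2 / 4" by (simp add: m_def)
  have m: "\<bar>e\<bar> \<le> m" "\<bar>\<beta>\<bar> \<le> m" "0 \<le> m"
    unfolding m_def using \<beta>(5) by (auto intro!: real_le_rsqrt)
  define T1 where "T1 = \<bar>\<beta> - e\<bar> / \<omega>_max P"
  define T2 where "T2 = 4 * t\<^sub>r P - T1"
  have T1: "0 \<le> T1" "\<bar>\<beta> - e\<bar> \<le> \<omega>_max P * T1" using pos by (auto simp: T1_def)
  have "\<omega>_max P * T1 + \<omega>_max P * T2 = 2 * pi"
    using pos by (simp add: T2_def t\<^sub>r_def algebra_simps)
  then have turn2: "\<bar>\<beta>\<bar> \<le> \<omega>_max P * T2" using \<beta>(4) pos by (simp add: T1_def)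
  then have T2: "0 \<le> T2" using pos by (smt (verit) mult_pos_neg)
  have "\<bar>l - x\<bar> \<le> \<bar>lam_min P + \<epsilon> P\<bar>" using x l by (auto simp: lam_min_def)
  then have "(l - x)\<^sup>2 \<le> (lam_min P + \<epsilon> P)\<^sup>2" using abs_le_square_iff by blast
  moreover have "\<bar>\<rho> P l - y\<bar> \<le> \<bar>2 * y_max P\<bar>" using y \<rho>l by auto
  then have "(\<rho> P l - y)\<^sup>2 \<le> (2 * y_max P)\<^sup>2" using abs_le_square_iff by blast
  ultimately have "d\<^sup>2 \<le> 4 * (y_max P)\<^sup>2 + (lam_min P + \<epsilon> P)\<^sup>2" using \<beta>(3) by simp
  then have "\<bar>d\<bar> \<le> sqrt (4 * (y_max P)\<^sup>2 + (lam_min P + \<epsilon> P)\<^sup>2)"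
    by (intro real_le_rsqrt) simp
  then have d: "\<bar>d\<bar> \<le> v_max P * t\<^sub>l P" using pos by (simp add: t\<^sub>l_def)
  have L: "?L = q\<^sub>1 P * (x - l)\<^sup>2 + q\<^sub>2 P * (y - \<rho> P l)\<^sup>2 + q\<^sub>3 P * e\<^sup>2 + q_hat P * l\<^sup>2"
    by (simp add: min_stage_cost_eq e_def \<psi>_def)
  have "steers P ((x, y, \<theta>), l) T1 ((x, y, \<psi> + \<beta>), l)
      (T1 * (?L + (q\<^sub>3 P * pi\<^sup>2 / 4 + r\<^sub>2 P * (\<omega>_max P)\<^sup>2)))"
    by (rule steers_mono[OF steers_turn[of _ _ _ _ _ _ m]])
       (use x y l T1 m in \<open>auto simp: e_def \<psi>_def[symmetric] L m_sq algebra_simps\<close>)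
  moreover have "steers P ((x, y, \<psi> + \<beta>), l) (t\<^sub>l P) ((l, \<rho> P l, \<psi> + \<beta>), l)
      (t\<^sub>l P * (?L + (q\<^sub>3 P * pi\<^sup>2 / 4 + r\<^sub>1 P * (v_max P)\<^sup>2)))"
  proof (rule steers_mono[OF steers_drive[of _ _ _ _ _ _ m]])
    show "\<bar>\<psi> + \<beta> - arctan (d\<rho> P l)\<bar> \<le> m" using m unfolding \<psi>_def by simp
    show "t\<^sub>l P * (q\<^sub>1 P * (x - l)\<^sup>2 + q\<^sub>2 P * (y - \<rho> P l)\<^sup>2 + q\<^sub>3 P * m\<^sup>2 + q_hat P * l\<^sup>2
        + r\<^sub>1 P * (v_max P)\<^sup>2) \<le> t\<^sub>l P * (?L + (q\<^sub>3 P * pi\<^sup>2 / 4 + r\<^sub>1 P * (v_max P)\<^sup>2))"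
      using times_pos by (intro mult_left_mono) (auto simp: L m_sq algebra_simps)
  qed (fact x y l times_pos(2) d \<beta>(1) \<beta>(2))+
  moreover have "steers P ((l, \<rho> P l, \<psi> + \<beta>), l) T2 ((l, \<rho> P l, \<psi>), l)
      (T2 * (?L + (q\<^sub>3 P * pi\<^sup>2 / 4 + r\<^sub>2 P * (\<omega>_max P)\<^sup>2)))"
  proof (rule steers_mono[OF steers_turn[of _ _ _ _ _ _ m]])
    \<comment> \<open>The position error is gone, so the position terms of \<open>?L\<close> are slack.\<close>
    have "0 \<le> q\<^sub>1 P * (x - l)\<^sup>2 + q\<^sub>2 P * (y - \<rho> P l)\<^sup>2" using cost_pos by simp
    then show "T2 * (q\<^sub>1 P * (l - l)\<^sup>2 + q\<^sub>2 P * (\<rho> P l - \<rho> P l)\<^sup>2 + q\<^sub>3 P * m\<^sup>2 + q_hat P * l\<^sup>2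
        + r\<^sub>2 P * (\<omega>_max P)\<^sup>2) \<le> T2 * (?L + (q\<^sub>3 P * pi\<^sup>2 / 4 + r\<^sub>2 P * (\<omega>_max P)\<^sup>2))"
      using T2 by (intro mult_left_mono) (auto simp: L m_sq algebra_simps)
  qed (use l l' \<rho>l T2 turn2 m in \<open>auto simp: \<psi>_def[symmetric]\<close>)
  ultimately have "steers P ((x, y, \<theta>), l) (T1 + t\<^sub>l P + T2) ((l, \<rho> P l, \<psi>), l)
     (T1 * (?L + (q\<^sub>3 P * pi\<^sup>2 / 4 + r\<^sub>2 P * (\<omega>_max P)\<^sup>2))
      + t\<^sub>l P * (?L + (q\<^sub>3 P * pi\<^sup>2 / 4 + r\<^sub>1 P * (v_max P)\<^sup>2))
      + T2 * (?L + (q\<^sub>3 P * pi\<^sup>2 / 4 + r\<^sub>2 P * (\<omega>_max P)\<^sup>2)))"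
    by (blast intro: steers_trans)
  moreover have "T1 + t\<^sub>l P + T2 = t_join" by (simp add: T2_def t_join_def)
  moreover have "T1 * (?L + p) + t\<^sub>l P * (?L + q) + T2 * (?L + p)
      = t_join * ?L + 4 * t\<^sub>r P * p + t\<^sub>l P * q" for p q
    by (simp add: T2_def t_join_def algebra_simps)
  ultimately show ?thesis by (simp only: ref_path_def \<psi>_def)
qed

text \<open>If \<open>l \<le> - \<epsilon> P\<close>, the excess of the manoeuvre is converted into a multiple of the optimal stage
  cost, which is at least \<open>q_hat \<epsilon>\<^sup>2\<close>. On the path it suffices to wait, because \<open>c \<ge> 1\<close> up to
  \<open>t_join\<close>.\<close>

lemma steers_join:
  assumes z: "((x, y, \<theta>), l) \<in> Z P" and err: "\<bar>\<theta> - arctan (d\<rho> P l)\<bar> \<le> 2 * pi"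
  shows "steers P ((x, y, \<theta>), l) t_join (ref_path P l, l)
    (integral {0..t_join} (c_fun P) * min_stage_cost P ((x, y, \<theta>), l))"
proof -
  let ?L = "min_stage_cost P ((x, y, \<theta>), l)"
  define E where "E = 4 * t\<^sub>r P * (q\<^sub>3 P * pi\<^sup>2 / 4 + r\<^sub>2 P * (\<omega>_max P)\<^sup>2)
      + t\<^sub>l P * (q\<^sub>3 P * pi\<^sup>2 / 4 + r\<^sub>1 P * (v_max P)\<^sup>2)"
  let ?D = "q_hat P * (\<epsilon> P)\<^sup>2"
  have E: "0 \<le> E" using times_pos cost_pos by (simp add: E_def)
  have D: "0 < ?D" using cost_pos eps by simp
  have c: "t_join + E / ?D \<le> integral {0..t_join} (c_fun P)"
    using c_integral_join_ge unfolding E_def .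
  have L: "0 \<le> ?L" by (rule min_stage_cost_nonneg)
  consider (free) "((x, y, \<theta>), l) \<in> X P (\<epsilon> P) \<times> {lam_min P .. - \<epsilon> P}"
    | (path) "(x, y, \<theta>) = ref_path P l"
    using z by (auto simp: Z_def)
  then show ?thesis
  proof cases
    case free
    have "\<bar>\<epsilon> P\<bar> \<le> \<bar>l\<bar>" using free eps by auto
    then have "(\<epsilon> P)\<^sup>2 \<le> l\<^sup>2" using abs_le_square_iff by blast
    then have "?D \<le> q_hat P * l\<^sup>2" using cost_pos by simp
    also have "\<dots> \<le> ?L" using min_stage_cost_ge[of "((x, y, \<theta>), l)"] by simp
    finally have "E / ?D * ?D \<le> E / ?D * ?L" using E D by (intro mult_left_mono) auto
    moreover have "E / ?D * ?D = E" using D by (intro nonzero_eq_divide_eq[THEN iffD1]) auto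
    ultimately have "t_join * ?L + E \<le> (t_join + E / ?D) * ?L" unfolding distrib_right by linarith
    also have "\<dots> \<le> integral {0..t_join} (c_fun P) * ?L" using c L by (rule mult_right_mono)
    finally show ?thesis
      using steers_mono[OF steers_to_path[OF free err]] unfolding E_def by (simp add: add.assoc)
  next
    case path
    have "t_join \<le> integral {0..t_join} (c_fun P)" using c E D by (smt (verit) divide_nonneg_pos)
    then have "t_join * ?L \<le> integral {0..t_join} (c_fun P) * ?L" using L by (rule mult_right_mono)
    then show ?thesis
      using steers_mono[OF steers_rest[OF z]] t_join_pos path by simp
  qed
qed

lemma steers_after_join:
  assumes "l \<in> {lam_min P .. 0}" "t_join \<le> t"
  shows "\<exists>z. steers P (ref_path P l, l) (t - t_join) z (integral {t_join..t} (c_fun P) * (q_hat P * l\<^sup>2))"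
proof (cases "t \<le> t_join + t\<^sub>g P")
  case True
  then show ?thesis
    using steers_along_path[OF assms(1), of "t - t_join"] c_integral_path[of "t - t_join"] assms(2)
    by (intro exI[of _ "(ref_path P (l - l / t\<^sub>g P * (t - t_join)), l - l / t\<^sub>g P * (t - t_join))"])
       (simp add: mult.commute)
next
  case False
  have arrive: "steers P (ref_path P l, l) (t\<^sub>g P) (ref_path P 0, 0)
      (q_hat P * l\<^sup>2 * integral {t_join .. t_join + t\<^sub>g P} (c_fun P))"
    using steers_along_path[OF assms(1), of "t\<^sub>g P"] c_integral_path[of "t\<^sub>g P"] times_pos by simp
  have "(ref_path P 0, 0) \<in> Z P" using lam_min_less by (intro path_state_in_Z) auto
  then have stay: "steers P (ref_path P 0, 0) (t - t_join - t\<^sub>g P) (ref_path P 0, 0)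
      ((t - t_join - t\<^sub>g P) * min_stage_cost P (ref_path P 0, 0))"
    using False by (intro steers_rest) auto
  have "integral {t_join..t} (c_fun P) = integral {t_join .. t_join + t\<^sub>g P} (c_fun P)
      + integral {t_join + t\<^sub>g P .. t} (c_fun P)"
    using c_integral_split[of t_join t] c_integral_split[of t_join "t_join + t\<^sub>g P"]
      c_integral_split[of "t_join + t\<^sub>g P" t] t_join_pos times_pos False by simp
  moreover have "integral {t_join + t\<^sub>g P .. t} (c_fun P) = integral {t_join + t\<^sub>g P .. t} (\<lambda>_. 0)"
    by (rule integral_cong) (simp add: c_fun_late)
  ultimately show ?thesis
    using steers_trans[OF arrive stay]
    by (intro exI[of _ "(ref_path P 0, 0)"]) (simp add: min_stage_cost_on_path mult.commute)
qed

subsection \<open>Bounds on the value function\<close>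

lemma V_le_t:
  assumes "z \<in> Z P" "0 < t"
  shows "V P t z \<le> ereal (t * min_stage_cost P z)"
  using V_le_if_steers[OF steers_rest] assms by simp

text \<open>Up to \<open>t_join\<close> resting is cheap enough since \<open>c \<ge> 1\<close>; beyond it the manoeuvre is complete.\<close>

lemma V_le_integral:
  assumes z: "z \<in> Z P" and err: "\<bar>heading_error P z\<bar> \<le> 2 * pi" and t: "0 < t"
  shows "V P t z \<le> ereal (integral {0..t} (c_fun P) * min_stage_cost P z)"
proof (cases "t < t_join")
  case True
  have "integral {0..t} (\<lambda>_. 1) \<le> integral {0..t} (c_fun P)"
    using c_fun_integrable c_fun_ge_1 True by (intro integral_le) auto
  then have "t * min_stage_cost P z \<le> integral {0..t} (c_fun P) * min_stage_cost P z"
    using t min_stage_cost_nonneg by (intro mult_right_mono) auto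
  then show ?thesis using V_le_t[OF z t] by (meson ereal_less_eq(3) order_trans)
next
  case False
  obtain x y \<theta> l where z_eq: "z = ((x, y, \<theta>), l)" by (metis prod.exhaust)
  have l: "l \<in> {lam_min P .. 0}" using z lam_min_less eps by (auto simp: z_eq Z_def)
  have join: "steers P z t_join (ref_path P l, l) (integral {0..t_join} (c_fun P) * min_stage_cost P z)"
    using steers_join z err by (simp add: z_eq)
  obtain z' where "steers P (ref_path P l, l) (t - t_join) z'
      (integral {t_join..t} (c_fun P) * (q_hat P * l\<^sup>2))"
    using steers_after_join[OF l] False by force
  from steers_trans[OF join this]
  have "steers P z t z' (integral {0..t_join} (c_fun P) * min_stage_cost P z
      + integral {t_join..t} (c_fun P) * (q_hat P * l\<^sup>2))" by simp
  moreover have "0 \<le> integral {t_join..t} (c_fun P)"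
    using c_fun_integrable_Icc c_fun_nonneg t_join_pos by (intro integral_nonneg) auto
  then have "integral {t_join..t} (c_fun P) * (q_hat P * l\<^sup>2)
      \<le> integral {t_join..t} (c_fun P) * min_stage_cost P z"
    using min_stage_cost_ge[of z] by (intro mult_left_mono) (auto simp: z_eq)
  then have "integral {0..t_join} (c_fun P) * min_stage_cost P z
      + integral {t_join..t} (c_fun P) * (q_hat P * l\<^sup>2)
      \<le> integral {0..t} (c_fun P) * min_stage_cost P z"
    using c_integral_split[of t_join t] t_join_pos False by (simp add: algebra_simps)
  ultimately show ?thesis using V_le_if_steers[OF steers_mono] t by blast
qed

lemma V_le_B_fun:
  assumes "z \<in> Z P" "\<bar>heading_error P z\<bar> \<le> 2 * pi" "0 \<le> t"
  shows "V P t z \<le> ereal (B_fun P t * min_stage_cost P z)"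
proof (cases "t = 0")
  case True
  then show ?thesis by (simp add: V_def B_fun_def)
next
  case False
  then show ?thesis
    using assms V_le_t V_le_integral by (auto simp: B_fun_def min_def)
qed

lemma B_fun_nonneg: "0 \<le> t \<Longrightarrow> 0 \<le> B_fun P t"
  using c_fun_integrable c_fun_nonneg by (auto simp: B_fun_def intro!: integral_nonneg)

lemma B_fun_continuous: "continuous_on {0..} (B_fun P)"
proof -
  have "continuous (at t within {0..}) (\<lambda>t. integral {0..t} (c_fun P))" if "0 \<le> t" for t
  proof -
    have "continuous_on {0..t + 1} (\<lambda>t. integral {0..t} (c_fun P))"
      by (rule indefinite_integral_continuous_1) (rule c_fun_integrable)
    then have "continuous (at t within {0..t + 1}) (\<lambda>t. integral {0..t} (c_fun P))"
      using that by (simp add: continuous_on_eq_continuous_within)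
    moreover have "at t within {0..t + 1} = at t within {0..}"
      using that by (intro at_within_nhd[of _ "{..<t + 1}"]) auto
    ultimately show ?thesis by simp
  qed
  then have "continuous_on {0..} (\<lambda>t. integral {0..t} (c_fun P))"
    by (simp add: continuous_on_eq_continuous_within)
  then show ?thesis unfolding B_fun_def by (intro continuous_intros)
qed

end

theorem theorem4p4:
  fixes P :: path_problem
  assumes "x_max P > 0" "y_max P > 0" "v_max P > 0" "\<omega>_max P > 0" "g_max P > 0"
    and "0 < \<epsilon> P" "\<epsilon> P < x_max P"
    and "\<rho> P differentiable_on {lam_min P .. 0}" "d\<rho> P differentiable_on {lam_min P .. 0}"
      "continuous_on {lam_min P .. 0} (dd\<rho> P)"
    and "ref_path P ` {lam_min P .. 0} \<subseteq> X P 0" "ref_path P 0 = (0, 0, 0)"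
    and "q\<^sub>1 P > 0" "q\<^sub>2 P > 0" "q\<^sub>3 P > 0" "q_hat P > 0"
    and "r\<^sub>1 P > 0" "r\<^sub>2 P > 0" "r_hat P > 0"
    and "value_attained P"
    and "r\<^sub>2 P \<le> q\<^sub>3 P / 2"
  shows "piecewise_continuous_on {0..} (B_fun P) \<and> (\<forall>t\<ge>0. B_fun P t \<ge> 0) \<and>
    (\<forall>z\<^sub>0 \<in> Z P. \<bar>heading_error P z\<^sub>0\<bar> \<le> 2 * pi \<longrightarrow>
      (\<forall>t\<ge>0. V P t z\<^sub>0 \<le> ereal (B_fun P t * min_stage_cost P z\<^sub>0)))"
proof -
  interpret path_following P
    by unfold_locales (use assms in auto)
  have "piecewise_continuous_on {0..} (B_fun P)"
    using B_fun_continuous by (rule continuous_on_imp_piecewise_continuous_on) auto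
  then show ?thesis using B_fun_nonneg V_le_B_fun by blast
qed

end
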